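(* CPDA (Class-Conditional Path Distribution Alignment) contains several commonly used discrepancy principles as limiting or restricted cases. 1. If class conditioning is removed and only the pooled kernel $k_{\mathrm{pool}}$ is used, CPDA reduces to standard marginal MMD on pooled features. 2. If a linear kernel is used on pooled features, CPDA reduces to first-order mean matching. 3. If a linear kernel is used on centered quadratic feature maps, the induced MMD equals covariance matching, corresponding to CORAL-type alignment. 4. If polynomial feature maps of order $p$ are used, CPDA aligns moments up to order $p$, recovering the principle behind higher-order moment matching such as HoMM. 5. If CPDA is evaluated at several network layers, it recovers the multi-layer distribution-matching principle used by DAN-like methods, while retaining class conditioning and temporal structure.
   Context: Setting. $x_1^s,\dots,x_{n_s}^s$ are source samples with labels $y_i^s\in\{1,\dots,K\}$ and $x_1^t,\dots,x_{n_t}^t$ are unlabeled target samples, all in $\mathcal X\subseteq\mathbb R^{C_{\mathrm{in}}\times L}$ (multivariate time-series); $P_s,P_t$ are the source and target distributions. A feature extractor $f_\theta$ maps $x$ to a latent temporal path $Z_\theta(x)=(z_1,\dots,z_T)$, $z_t\in\mathbb R^d$, and a classifier $g_\phi$ gives softmax probabilities $q(c\mid x)=\mathrm{softmax}(g_\phi(f_\theta(x)))_c$, used as soft pseudo-labels on the target. Kernel. Put $\Delta z_t=z_t-z_{t-1}$, $\Delta z_1=0$, $A_\theta(x)_t=[t/T,z_t,\Delta z_t]$. The representations are: pooled, $\psi_{\mathrm{pool}}(x)=\frac1T\sum_{t=1}^Tz_t$; path, $\psi_{\mathrm{path}}(x)=\mathrm{vec}(A_\theta(x)_1,\dots,A_\theta(x)_T)$;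 spectral, $\psi_{\mathrm{spec}}(x)=\mathrm{vec}(\log(1+|\mathcal F_t[Z_\theta(x)]|^2))$ with $\mathcal F_t$ the discrete Fourier transform along time; signature, $\psi_{\mathrm{sig}}(x)=[S_1(x),\mathrm{vec}(S_2(x))]$, where $u_t=P([\frac{t+1}T,z_{t+1}]-[\frac tT,z_t])$ for $t=1,\dots,T-1$, $P\in\mathbb R^{r\times(d+1)}$ is a fixed random projection matrix, $S_1=\sum_{t=1}^{T-1}u_t$ and $S_2=\sum_{1\le i<j\le T-1}u_i\otimes u_j$. For $a\in\{\mathrm{sig},\mathrm{spec},\mathrm{path},\mathrm{pool}\}$, with $\overline\psi_a$ the ($\ell_2$-)normalized representation, $k_a(x,x')=\frac1M\sum_{m=1}^M\exp(-\|\overline\psi_a(x)-\overline\psi_a(x')\|_2^2/\sigma_{a,m}^2)$ (a single Gaussian kernel if $M=1$). The CPDA kernel is $k_{\mathrm{CPDA}}=\alpha_{\mathrm{sig}}k_{\mathrm{sig}}+\alpha_{\mathrm{spec}}k_{\mathrm{spec}}+\alpha_{\mathrm{path}}k_{\mathrm{path}}+\alpha_{\mathrm{pool}}k_{\mathrm{pool}}$ with all $\alpha_a\ge0$ and RKHS $\mathcal H_{\mathrm{CPDA}}$. CPDA discrepancy. With class weights $\bar w^s_{i,c}=\mathbb I[y_i^s=c]/\sum_{i'}\mathbb I[y_{i'}^s=c]$ and $\bar w^t_{j,c}=q(c\mid x_j^t)/\sum_{j'}q(c\mid x_{j'}^t)$, class-conditional mean embeddings $\widehat\mu_{s,c}=\sum_i\bar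 w^s_{i,c}k_{\mathrm{CPDA}}(x_i^s,\cdot)$ and $\widehat\mu_{t,c}=\sum_j\bar w^t_{j,c}k_{\mathrm{CPDA}}(x_j^t,\cdot)$, and estimated target priors $\widehat\pi_t(c)=\frac1{n_t}\sum_jq(c\mid x_j^t)$, the discrepancy is $$\widehat{\mathcal D}^2_{\mathrm{CPDA}}=\sum_{c=1}^K\widehat\pi_t(c)\,\|\widehat\mu_{s,c}-\widehat\mu_{t,c}\|^2_{\mathcal H_{\mathrm{CPDA}}}.$$ Meaning of the restrictions. "Restricted cases" are obtained by restricting the feature map and the conditioning structure of CPDA. Removing class conditioning means replacing the class-conditional weights by uniform weights; using only $k_{\mathrm{pool}}$ means $\alpha_{\mathrm{sig}}=\alpha_{\mathrm{spec}}=\alpha_{\mathrm{path}}=0$, $\alpha_{\mathrm{pool}}>0$; the marginal empirical MMD is then $\|\widehat\mu_s-\widehat\mu_t\|^2_{\mathcal H}$ with $\widehat\mu_s,\widehat\mu_t$ the uniformly weighted mean embeddings. The linear kernel on pooled features is $k(x,x')=\psi_{\mathrm{pool}}(x)^\top\psi_{\mathrm{pool}}(x')$, and first-order mean matching is the discrepancy $\|\mathbb E_{P_s}\psi_{\mathrm{pool}}(X)-\mathbb E_{P_t}\psi_{\mathrm{pool}}(X)\|_2^2$. A centered quadratic feature map is $\psi_2(x)=\mathrm{vec}((\psi(x)-\mu)(\psi(x)-\mu)^\top)$ for a feature map $\psi$ and centering mean $\mu$; its linear MMD is $\|\mathbb E_{P_s}\psi_2(X)-\mathbb E_{P_t}\psi_2(X)\|_2^2$,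 and covariance matching is $\|C_s-C_t\|_F^2$ with $C_s,C_t$ the source and target feature covariance matrices (the core discrepancy of CORAL, correlation alignment). Polynomial feature maps of order $p$ encode tensor products of features up to order $p$; HoMM (higher-order moment matching) minimizes $\|\mathbb E_{P_s}[F^{\otimes p}]-\mathbb E_{P_t}[F^{\otimes p}]\|_F^2$ for features $F$. Evaluating CPDA at several layers means summing CPDA discrepancies over multiple network layers; DAN (deep adaptation networks) minimizes a sum over layers of squared (multi-kernel) MMDs between the source and target feature distributions.
   Formalization: Item 3 fails for an arbitrary shared centering mean μ; equality with covariance matching is proved when (m_s−μ)(m_s−μ)^T = (m_t−μ)(m_t−μ)^T (e.g. equal means), and unconditionally when each domain is centered at its own mean. *)

theory Defs
  imports "HOL-Probability.Probability_Measure" "Jordan_Normal_Form.Matrix"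
begin

text \<open>
  Feature dimensions and path lengths vary from layer to layer, so feature vectors and matrices
  are those of Jordan_Normal_Form (dimension as a value). Only the inputs, elements of
  \<open>(real^'L)^'C\<close>, use the typed vectors of HOL-Analysis.
\<close>

hide_type (open) Finite_Cartesian_Product.vec
hide_const (open) Finite_Cartesian_Product.vec Finite_Cartesian_Product.mat
no_notation Finite_Cartesian_Product.vec_nth (infixl \<open>$\<close> 90)
no_notation Inner_Product.real_inner_class.inner (infix \<open>\<bullet>\<close> 70)

section \<open>Vectors and matrices\<close>

definition l2norm :: "real vec \<Rightarrow> real" where
  "l2norm v = sqrt (v \<bullet> v)"

text \<open>The zero vector is its own normalization, since \<open>1 / 0 = 0\<close>.\<close>

definition normalized :: "real vec \<Rightarrow> real vec" where
  "normalized v = (1 / l2norm v) \<cdot>\<^sub>v v"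

definition outer :: "real vec \<Rightarrow> real vec \<Rightarrow> real mat" where
  "outer u v = mat (dim_vec u) (dim_vec v) (\<lambda>(i, j). u $ i * v $ j)"

definition vectorize :: "real mat \<Rightarrow> real vec" where
  "vectorize A = vec_of_list (concat (mat_to_list A))"

definition fnorm :: "real mat \<Rightarrow> real" where
  "fnorm A = sqrt (\<Sum>i<dim_row A. \<Sum>j<dim_col A. (A $$ (i, j))\<^sup>2)"

text \<open>
  The tensor power of order \<open>m\<close> of an \<open>n\<close>-vector, flattened to an \<open>n ^ m\<close>-vector whose entries
  are indexed by the words of length \<open>m\<close> over \<open>{0..<n}\<close>; its Frobenius norm is \<open>l2norm\<close>.
\<close>

definition tensor_pow :: "nat \<Rightarrow> real vec \<Rightarrow> real vec" where
  "tensor_pow m v =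
     vec_of_list (map (\<lambda>w. \<Prod>i\<leftarrow>w. v $ i) (List.n_lists m [0..<dim_vec v]))"

section \<open>Reproducing kernel Hilbert spaces and mean embeddings\<close>

text \<open>
  Functions on \<open>X\<close> are functions on the whole type that vanish outside \<open>X\<close>. \<open>H\<close> is the underlying
  set of the space and \<open>ip\<close> its inner product, which is unconstrained outside \<open>H\<close>. By the
  Moore-Aronszajn theorem every symmetric positive semidefinite kernel on \<open>X\<close> has exactly one such \<open>H\<close>, with
  \<open>ip\<close> unique on \<open>H\<close>.
\<close>

definition ksection :: "'a set \<Rightarrow> ('a \<Rightarrow> 'a \<Rightarrow> real) \<Rightarrow> 'a \<Rightarrow> 'a \<Rightarrow> real" where
  "ksection X k x = (\<lambda>y. if y \<in> X then k x y else 0)"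

definition hnorm :: "(('a \<Rightarrow> real) \<Rightarrow> ('a \<Rightarrow> real) \<Rightarrow> real) \<Rightarrow> ('a \<Rightarrow> real) \<Rightarrow> real" where
  "hnorm ip f = sqrt (ip f f)"

locale rkhs =
  fixes X :: "'a set"
    and k :: "'a \<Rightarrow> 'a \<Rightarrow> real"
    and H :: "('a \<Rightarrow> real) set"
    and ip :: "('a \<Rightarrow> real) \<Rightarrow> ('a \<Rightarrow> real) \<Rightarrow> real"
  assumes zero_mem: "(\<lambda>_. 0) \<in> H"
    and add_mem: "\<lbrakk>f \<in> H; g \<in> H\<rbrakk> \<Longrightarrow> (\<lambda>x. f x + g x) \<in> H"
    and scale_mem: "f \<in> H \<Longrightarrow> (\<lambda>x. a * f x) \<in> H"
    and supp: "\<lbrakk>f \<in> H; x \<notin> X\<rbrakk> \<Longrightarrow> f x = 0"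
    and ip_sym: "\<lbrakk>f \<in> H; g \<in> H\<rbrakk> \<Longrightarrow> ip f g = ip g f"
    and ip_add: "\<lbrakk>f \<in> H; g \<in> H; h \<in> H\<rbrakk> \<Longrightarrow> ip (\<lambda>x. f x + g x) h = ip f h + ip g h"
    and ip_scale: "\<lbrakk>f \<in> H; h \<in> H\<rbrakk> \<Longrightarrow> ip (\<lambda>x. a * f x) h = a * ip f h"
    and ip_nonneg: "f \<in> H \<Longrightarrow> 0 \<le> ip f f"
    and ip_definite: "\<lbrakk>f \<in> H; ip f f = 0\<rbrakk> \<Longrightarrow> f = (\<lambda>_. 0)"
    and complete: "\<lbrakk>\<And>n. F n \<in> H;
        \<And>e. e > 0 \<Longrightarrow> \<exists>N. \<forall>m\<ge>N. \<forall>n\<ge>N. hnorm ip (\<lambda>x. F m x - F n x) < e\<rbrakk>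
      \<Longrightarrow> \<exists>f\<in>H. (\<lambda>n. hnorm ip (\<lambda>x. F n x - f x)) \<longlonglongrightarrow> 0"
    and section_mem: "x \<in> X \<Longrightarrow> ksection X k x \<in> H"
    and reproducing: "\<lbrakk>f \<in> H; x \<in> X\<rbrakk> \<Longrightarrow> ip f (ksection X k x) = f x"

text \<open>
  A (sub-)distribution on \<open>'a\<close> is given by its expectation operator \<open>E\<close>: \<open>integral\<^sup>L P\<close> for a
  measure \<open>P\<close>, \<open>weighted n x w\<close> for the point masses \<open>w i\<close> at the samples \<open>x i\<close>, \<open>1 \<le> i \<le> n\<close>.
  The embedding of the latter is \<open>\<Sum>i=1..n. w i * k (x i) \<cdot>\<close>.
\<close>

type_synonym 'a expect = "('a \<Rightarrow> real) \<Rightarrow> real"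

definition weighted :: "nat \<Rightarrow> (nat \<Rightarrow> 'a) \<Rightarrow> (nat \<Rightarrow> real) \<Rightarrow> 'a expect" where
  "weighted n x w = (\<lambda>f. \<Sum>i=1..n. w i * f (x i))"

definition uniform :: "nat \<Rightarrow> (nat \<Rightarrow> 'a) \<Rightarrow> 'a expect" where
  "uniform n x = weighted n x (\<lambda>_. 1 / real n)"

definition push :: "'a expect \<Rightarrow> ('a \<Rightarrow> 'b) \<Rightarrow> 'b expect" where
  "push E \<phi> = (\<lambda>f. E (\<lambda>x. f (\<phi> x)))"

definition embedding :: "'a set \<Rightarrow> ('a \<Rightarrow> 'a \<Rightarrow> real) \<Rightarrow> 'a expect \<Rightarrow> 'a \<Rightarrow> real" where
  "embedding X k E = (\<lambda>y. if y \<in> X then E (\<lambda>x. k x y) else 0)"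

definition mmd2 ::
  "'a set \<Rightarrow> ('a \<Rightarrow> 'a \<Rightarrow> real) \<Rightarrow> (('a \<Rightarrow> real) \<Rightarrow> ('a \<Rightarrow> real) \<Rightarrow> real) \<Rightarrow>
   'a expect \<Rightarrow> 'a expect \<Rightarrow> real" where
  "mmd2 X k ip E E' = (hnorm ip (\<lambda>y. embedding X k E y - embedding X k E' y))\<^sup>2"

definition linear_kernel :: "('a \<Rightarrow> real vec) \<Rightarrow> 'a \<Rightarrow> 'a \<Rightarrow> real" where
  "linear_kernel \<phi> x x' = \<phi> x \<bullet> \<phi> x'"

section \<open>Moments\<close>

definition integrable_vec :: "'a measure \<Rightarrow> nat \<Rightarrow> ('a \<Rightarrow> real vec) \<Rightarrow> bool" where
  "integrable_vec P n \<phi> \<longleftrightarrow> (\<forall>i<n. integrable P (\<lambda>x. \<phi> x $ i))"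

definition mean_vec :: "'a expect \<Rightarrow> nat \<Rightarrow> ('a \<Rightarrow> real vec) \<Rightarrow> real vec" where
  "mean_vec E n \<phi> = vec n (\<lambda>i. E (\<lambda>x. \<phi> x $ i))"

definition cov_mat :: "'a expect \<Rightarrow> nat \<Rightarrow> ('a \<Rightarrow> real vec) \<Rightarrow> real mat" where
  "cov_mat E n \<phi> = mat n n (\<lambda>(i, j).
     E (\<lambda>x. (\<phi> x $ i - mean_vec E n \<phi> $ i) * (\<phi> x $ j - mean_vec E n \<phi> $ j)))"

definition mean_disc :: "nat \<Rightarrow> ('a \<Rightarrow> real vec) \<Rightarrow> 'a expect \<Rightarrow> 'a expect \<Rightarrow> real" where
  "mean_disc n \<phi> E E' = (l2norm (mean_vec E n \<phi> - mean_vec E' n \<phi>))\<^sup>2"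

definition coral_disc :: "nat \<Rightarrow> ('a \<Rightarrow> real vec) \<Rightarrow> 'a expect \<Rightarrow> 'a expect \<Rightarrow> real" where
  "coral_disc n \<phi> E E' = (fnorm (cov_mat E n \<phi> - cov_mat E' n \<phi>))\<^sup>2"

definition homm_disc :: "nat \<Rightarrow> nat \<Rightarrow> ('a \<Rightarrow> real vec) \<Rightarrow> 'a expect \<Rightarrow> 'a expect \<Rightarrow> real" where
  "homm_disc p n F E E' = mean_disc (n ^ p) (\<lambda>x. tensor_pow p (F x)) E E'"

text \<open>
  The mean of \<open>quad_feature \<mu> \<circ> \<psi>\<close> under \<open>E\<close> is \<open>vectorize\<close> of \<open>cov_mat E n \<psi> + outer (m - \<mu>) (m - \<mu>)\<close>
  with \<open>m = mean_vec E n \<psi>\<close>. One \<open>\<mu>\<close> shared by source and target therefore gives covariance matching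
  only if the two rank-one terms agree (e.g. equal means). Centering each domain at its own mean is
  \<open>quad_feature (0\<^sub>v n)\<close> on the distributions of \<open>\<psi> x - m\<close>.
\<close>

definition quad_feature :: "real vec \<Rightarrow> real vec \<Rightarrow> real vec" where
  "quad_feature \<mu> v = vectorize (outer (v - \<mu>) (v - \<mu>))"

text \<open>
  The concatenation of the blocks \<open>b m \<cdot> v\<^sup>\<otimes>\<^sup>m\<close> for \<open>m = 0, \<dots>, p\<close>. All \<open>b m = 1\<close> is the plain
  feature map, \<open>b m = sqrt ((p choose m) * a ^ (p - m))\<close> gives the kernel \<open>(u \<bullet> v + a) ^ p\<close>, and the
  indicator of \<open>m = p\<close> gives \<open>(u \<bullet> v) ^ p\<close>.
\<close>

definition poly_feature :: "(nat \<Rightarrow> real) \<Rightarrow> nat \<Rightarrow> real vec \<Rightarrow> real vec" where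
  "poly_feature b p v =
     vec_of_list (concat (map (\<lambda>m. list_of_vec (b m \<cdot>\<^sub>v tensor_pow m v)) [0..<Suc p]))"

section \<open>Path representations and the CPDA kernel\<close>

datatype rep = Sig | Spec | Path | Pool

text \<open>Latent paths \<open>z\<close> are indexed from 1: \<open>z 1, \<dots>, z T\<close>.\<close>

type_synonym path = "nat \<Rightarrow> real vec"

definition increment :: "nat \<Rightarrow> path \<Rightarrow> nat \<Rightarrow> real vec" where
  "increment d z t = (if t = 1 then 0\<^sub>v d else z t - z (t - 1))"

definition pool_rep :: "nat \<Rightarrow> nat \<Rightarrow> path \<Rightarrow> real vec" where
  "pool_rep T d z = vec d (\<lambda>j. (1 / real T) * (\<Sum>t=1..T. z t $ j))"

definition path_rep :: "nat \<Rightarrow> nat \<Rightarrow> path \<Rightarrow> real vec" where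
  "path_rep T d z = vec_of_list (concat
     (map (\<lambda>t. list_of_vec (vCons (real t / real T) (z t @\<^sub>v increment d z t))) [1..<Suc T]))"

definition dft :: "nat \<Rightarrow> path \<Rightarrow> nat \<Rightarrow> nat \<Rightarrow> complex" where
  "dft T z f j =
     (\<Sum>t=1..T. complex_of_real (z t $ j) * cis (- 2 * pi * real f * real (t - 1) / real T))"

definition spec_rep :: "nat \<Rightarrow> nat \<Rightarrow> path \<Rightarrow> real vec" where
  "spec_rep T d z = vec_of_list (concat
     (map (\<lambda>f. map (\<lambda>j. ln (1 + (cmod (dft T z f j))\<^sup>2)) [0..<d]) [0..<T]))"

definition sig_step :: "nat \<Rightarrow> real mat \<Rightarrow> path \<Rightarrow> nat \<Rightarrow> real vec" where
  "sig_step T P z t =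
     P *\<^sub>v (vCons (real (t + 1) / real T) (z (t + 1)) - vCons (real t / real T) (z t))"

definition sig1 :: "nat \<Rightarrow> real mat \<Rightarrow> path \<Rightarrow> real vec" where
  "sig1 T P z = vec (dim_row P) (\<lambda>a. \<Sum>t=1..T-1. sig_step T P z t $ a)"

definition sig2 :: "nat \<Rightarrow> real mat \<Rightarrow> path \<Rightarrow> real mat" where
  "sig2 T P z = mat (dim_row P) (dim_row P) (\<lambda>(a, b).
     \<Sum>(i, j) \<in> {(i, j). 1 \<le> i \<and> i < j \<and> j \<le> T - 1}.
       outer (sig_step T P z i) (sig_step T P z j) $$ (a, b))"

definition sig_rep :: "nat \<Rightarrow> real mat \<Rightarrow> path \<Rightarrow> real vec" where
  "sig_rep T P z = sig1 T P z @\<^sub>v vectorize (sig2 T P z)"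

record 'x layer =
  tlen :: nat
  ldim :: nat
  latent :: "'x \<Rightarrow> path"
  proj :: "real mat"
  nscales :: nat
  bandwidth :: "rep \<Rightarrow> nat \<Rightarrow> real"
  alpha :: "rep \<Rightarrow> real"

definition path_space :: "'x layer \<Rightarrow> path set" where
  "path_space L = {z. \<forall>t\<in>{1..tlen L}. z t \<in> carrier_vec (ldim L)}"

definition valid_layer :: "'x set \<Rightarrow> 'x layer \<Rightarrow> bool" where
  "valid_layer X L \<longleftrightarrow>
     tlen L \<ge> 1 \<and> (\<forall>x\<in>X. latent L x \<in> path_space L) \<and> dim_col (proj L) = ldim L + 1 \<and>
     nscales L \<ge> 1 \<and> (\<forall>a. \<forall>m\<in>{1..nscales L}. bandwidth L a m > 0) \<and> (\<forall>a. alpha L a \<ge> 0)"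

fun rep_of :: "'x layer \<Rightarrow> rep \<Rightarrow> path \<Rightarrow> real vec" where
  "rep_of L Sig z = sig_rep (tlen L) (proj L) z"
| "rep_of L Spec z = spec_rep (tlen L) (ldim L) z"
| "rep_of L Path z = path_rep (tlen L) (ldim L) z"
| "rep_of L Pool z = pool_rep (tlen L) (ldim L) z"

definition gauss_kernel :: "nat \<Rightarrow> (nat \<Rightarrow> real) \<Rightarrow> real vec \<Rightarrow> real vec \<Rightarrow> real" where
  "gauss_kernel M \<sigma> u v = (1 / real M) * (\<Sum>m=1..M. exp (- (l2norm (u - v))\<^sup>2 / (\<sigma> m)\<^sup>2))"

text \<open>The kernels see an input only through its latent path; \<open>path_kernel\<close> acts on the paths.\<close>

definition rep_kernel :: "'x layer \<Rightarrow> rep \<Rightarrow> 'x \<Rightarrow> 'x \<Rightarrow> real" where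
  "rep_kernel L a x x' = gauss_kernel (nscales L) (bandwidth L a)
     (normalized (rep_of L a (latent L x))) (normalized (rep_of L a (latent L x')))"

definition path_kernel :: "'x layer \<Rightarrow> path \<Rightarrow> path \<Rightarrow> real" where
  "path_kernel L z z' = (\<Sum>a\<in>{Sig, Spec, Path, Pool}. alpha L a *
     gauss_kernel (nscales L) (bandwidth L a) (normalized (rep_of L a z)) (normalized (rep_of L a z')))"

definition cpda_kernel :: "'x layer \<Rightarrow> 'x \<Rightarrow> 'x \<Rightarrow> real" where
  "cpda_kernel L x x' =
     alpha L Sig * rep_kernel L Sig x x' + alpha L Spec * rep_kernel L Spec x x' +
     alpha L Path * rep_kernel L Path x x' + alpha L Pool * rep_kernel L Pool x x'"

section \<open>Class conditioning and the CPDA discrepancy\<close>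

definition softmax :: "nat \<Rightarrow> (nat \<Rightarrow> real) \<Rightarrow> nat \<Rightarrow> real" where
  "softmax K v c = exp (v c) / (\<Sum>c'=1..K. exp (v c'))"

definition src_weight :: "nat \<Rightarrow> (nat \<Rightarrow> nat) \<Rightarrow> nat \<Rightarrow> nat \<Rightarrow> real" where
  "src_weight ns y c i = of_bool (y i = c) / (\<Sum>i'=1..ns. of_bool (y i' = c))"

definition tgt_weight :: "nat \<Rightarrow> (nat \<Rightarrow> 'x) \<Rightarrow> (nat \<Rightarrow> 'x \<Rightarrow> real) \<Rightarrow> nat \<Rightarrow> nat \<Rightarrow> real" where
  "tgt_weight nt xt q c j = q c (xt j) / (\<Sum>j'=1..nt. q c (xt j'))"

definition tgt_prior :: "nat \<Rightarrow> (nat \<Rightarrow> 'x) \<Rightarrow> (nat \<Rightarrow> 'x \<Rightarrow> real) \<Rightarrow> nat \<Rightarrow> real" where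
  "tgt_prior nt xt q c = (1 / real nt) * (\<Sum>j=1..nt. q c (xt j))"

text \<open>
  The discrepancy for arbitrary class-indexed families \<open>Es\<close>, \<open>Et\<close>. CPDA has
  \<open>Es c = weighted ns xs (src_weight ns y c)\<close> and \<open>Et c = weighted nt xt (tgt_weight nt xt q c)\<close>;
  families that are constant in \<open>c\<close> express the removal of class conditioning.
\<close>

definition cpda2 ::
  "'x set \<Rightarrow> ('x \<Rightarrow> 'x \<Rightarrow> real) \<Rightarrow> (('x \<Rightarrow> real) \<Rightarrow> ('x \<Rightarrow> real) \<Rightarrow> real) \<Rightarrow>
   nat \<Rightarrow> (nat \<Rightarrow> real) \<Rightarrow> (nat \<Rightarrow> 'x expect) \<Rightarrow> (nat \<Rightarrow> 'x expect) \<Rightarrow> real" where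
  "cpda2 X k ip K \<pi> Es Et = (\<Sum>c=1..K. \<pi> c * mmd2 X k ip (Es c) (Et c))"

definition dan_objective ::
  "nat \<Rightarrow> (nat \<Rightarrow> 'z set) \<Rightarrow> (nat \<Rightarrow> 'z \<Rightarrow> 'z \<Rightarrow> real) \<Rightarrow>
   (nat \<Rightarrow> ('z \<Rightarrow> real) \<Rightarrow> ('z \<Rightarrow> real) \<Rightarrow> real) \<Rightarrow> (nat \<Rightarrow> 'z expect) \<Rightarrow> (nat \<Rightarrow> 'z expect) \<Rightarrow> real" where
  "dan_objective N Z k ip Es Et = (\<Sum>l=1..N. mmd2 (Z l) (k l) (ip l) (Es l) (Et l))"

definition multilayer_cpda2 ::
  "nat \<Rightarrow> (nat \<Rightarrow> 'x layer) \<Rightarrow> 'x set \<Rightarrow> (nat \<Rightarrow> ('x \<Rightarrow> real) \<Rightarrow> ('x \<Rightarrow> real) \<Rightarrow> real) \<Rightarrow>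
   nat \<Rightarrow> (nat \<Rightarrow> real) \<Rightarrow> (nat \<Rightarrow> 'x expect) \<Rightarrow> (nat \<Rightarrow> 'x expect) \<Rightarrow> real" where
  "multilayer_cpda2 N Ls X ip K \<pi> Es Et =
     (\<Sum>l=1..N. cpda2 X (cpda_kernel (Ls l)) (ip l) K \<pi> Es Et)"

end

theory Submission
  imports Defs
begin

text \<open>
  For samples the difference of embeddings is a finite combination of kernel sections, so its squared
  norm is a quadratic form in the kernel values, whatever the RKHS: rescaling the kernel, splitting
  it into a sum and factoring it through a map of the inputs are then visible on the form. For a linear
  kernel this also works for arbitrary distributions, because the difference of two mean vectors lies
  in the span of finitely many feature vectors, and the squared norm is the squared distance of
  the means; covariance and moment matching follow by computing the means of the quadratic and
  polynomial features.
\<close>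

text \<open>The inner product \<open>ip\<close> is unconstrained outside \<open>H\<close>, so the
  norm of a difference of embeddings says nothing until that difference is known to lie in
  \<open>H\<close>. A finite combination of kernel sections settles membership and value at once
  through the reproducing property. Two spaces such as \<open>H\<close> and \<open>H'\<close> are
  therefore compared through kernel values alone, without constructing a map between them. For a
  general measure the embedding is only a pointwise integral and need not be such a combination.
  Finite-dimensional features repair this, which is why the population versions occur with linear
  kernels, where integrability of the feature entries is enough to take expectations
  coordinatewise.\<close>

section \<open>Finite combinations of kernel sections\<close>

text \<open>Gaussian elimination of the last coordinate, since \<open>n\<close> is a value and not a type.\<close>

lemma finite_combination_of_annihilated:
  fixes \<phi> :: "'a \<Rightarrow> nat \<Rightarrow> real"
  assumes "\<And>u. (\<forall>x\<in>X. (\<Sum>i<n. u i * \<phi> x i) = 0) \<Longrightarrow> (\<Sum>i<n. u i * w i) = 0"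
  shows "\<exists>F c. finite F \<and> F \<subseteq> X \<and> (\<forall>i<n. w i = (\<Sum>x\<in>F. c x * \<phi> x i))"
  using assms
proof (induction n arbitrary: \<phi> w)
  case 0
  show ?case by (intro exI[of _ "{}"]) auto
next
  case (Suc n)
  show ?case
  proof (cases "\<exists>x\<in>X. \<phi> x n \<noteq> 0")
    case False
    have "w n = 0"
      using Suc.prems[of "\<lambda>i. of_bool (i = n)"] False by (simp add: of_bool_def if_distrib if_distribR)
    moreover have "\<exists>F c. finite F \<and> F \<subseteq> X \<and> (\<forall>i<n. w i = (\<Sum>x\<in>F. c x * \<phi> x i))"
    proof (rule Suc.IH)
      fix u assume u: "\<forall>x\<in>X. (\<Sum>i<n. u i * \<phi> x i) = 0"
      show "(\<Sum>i<n. u i * w i) = 0"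
        using Suc.prems[of u] u False \<open>w n = 0\<close> by simp
    qed
    then obtain F c where F: "finite F" "F \<subseteq> X" "\<And>i. i < n \<Longrightarrow> w i = (\<Sum>x\<in>F. c x * \<phi> x i)"
      by blast
    have "w i = (\<Sum>x\<in>F. c x * \<phi> x i)" if "i < Suc n" for i
    proof (cases "i = n")
      case True
      have "(\<Sum>x\<in>F. c x * \<phi> x n) = 0"
        using False F(2) by (intro sum.neutral) auto
      with True \<open>w n = 0\<close> show ?thesis by simp
    qed (use that F(3) in simp)
    with F show ?thesis by blast
  next
    case True
    then obtain x0 where x0: "x0 \<in> X" "\<phi> x0 n \<noteq> 0" by blast
    \<comment> \<open>\<open>r v\<close> is the multiple of \<open>\<phi> x0\<close> whose
      subtraction makes the last coordinate of \<open>v\<close> vanish. The induction hypothesis is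
      applied to the vectors reduced in this way.\<close>
    define r where "r v = v n / \<phi> x0 n" for v :: "nat \<Rightarrow> real"
    have "\<exists>F c. finite F \<and> F \<subseteq> X \<and>
        (\<forall>i<n. w i - r w * \<phi> x0 i = (\<Sum>x\<in>F. c x * (\<phi> x i - r (\<phi> x) * \<phi> x0 i)))"
    proof (rule Suc.IH)
      fix u assume u: "\<forall>x\<in>X. (\<Sum>i<n. u i * (\<phi> x i - r (\<phi> x) * \<phi> x0 i)) = 0"
      define t where "t = (\<Sum>i<n. u i * \<phi> x0 i)"
      \<comment> \<open>The last entry is chosen so that \<open>u'\<close> annihilates
        \<open>\<phi> x0\<close>. Then \<open>u'\<close> takes on any \<open>v\<close> the value
        that \<open>u\<close> takes on the reduction of \<open>v\<close>.\<close>
      define u' where "u' = u(n := - t / \<phi> x0 n)"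
      have ext: "(\<Sum>i<Suc n. u' i * v i) = (\<Sum>i<n. u i * (v i - r v * \<phi> x0 i))" for v
      proof -
        have "(\<Sum>i<n. u' i * v i) = (\<Sum>i<n. u i * v i)"
          by (rule sum.cong) (auto simp: u'_def)
        moreover have "(\<Sum>i<n. u i * (v i - r v * \<phi> x0 i)) = (\<Sum>i<n. u i * v i) - r v * t"
          by (simp add: t_def sum_distrib_left sum_subtractf algebra_simps)
        ultimately show ?thesis by (simp add: u'_def r_def)
      qed
      show "(\<Sum>i<n. u i * (w i - r w * \<phi> x0 i)) = 0"
        using Suc.prems[of u'] u unfolding ext by blast
    qed
    then obtain F c where F: "finite F" "F \<subseteq> X"
      "\<And>i. i < n \<Longrightarrow> w i - r w * \<phi> x0 i = (\<Sum>x\<in>F. c x * (\<phi> x i - r (\<phi> x) * \<phi> x0 i))"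
      by blast
    \<comment> \<open>Solving the reduced identity for \<open>w\<close> collects all multiples of
      \<open>\<phi> x0\<close> in \<open>b\<close>. Since \<open>x0\<close> may already belong to
      \<open>F\<close>, \<open>c'\<close> adds the two coefficients instead of overwriting
      one.\<close>
    define b where "b = r w - (\<Sum>x\<in>F. c x * r (\<phi> x))"
    define F' where "F' = insert x0 F"
    define c' where "c' x = (if x \<in> F then c x else 0) + (if x = x0 then b else 0)" for x
    have sum': "(\<Sum>x\<in>F'. c' x * h x) = (\<Sum>x\<in>F. c x * h x) + b * h x0" for h :: "'a \<Rightarrow> real"
    proof -
      have "(\<Sum>x\<in>F'. c' x * h x) =
          (\<Sum>x\<in>F'. if x \<in> F then c x * h x else 0) + (\<Sum>x\<in>F'. if x = x0 then b * h x else 0)"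
        unfolding c'_def sum.distrib[symmetric] by (intro sum.cong) (auto simp: algebra_simps)
      moreover have "(\<Sum>x\<in>F'. if x \<in> F then c x * h x else 0) = (\<Sum>x\<in>F. c x * h x)"
        using F(1) by (intro sum.mono_neutral_cong_right) (auto simp: F'_def)
      ultimately show ?thesis using F(1) by (simp add: F'_def)
    qed
    have "w i = (\<Sum>x\<in>F'. c' x * \<phi> x i)" if "i < Suc n" for i
    proof (cases "i = n")
      case True
      have "(\<Sum>x\<in>F. c x * \<phi> x n) = (\<Sum>x\<in>F. c x * r (\<phi> x)) * \<phi> x0 n"
        using x0 by (simp add: r_def sum_distrib_right)
      then show ?thesis
        using True x0 unfolding sum' b_def by (simp add: algebra_simps r_def[of w])
    next
      case False
      then have "w i = r w * \<phi> x0 i + (\<Sum>x\<in>F. c x * (\<phi> x i - r (\<phi> x) * \<phi> x0 i))"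
        using that F(3)[of i] by simp
      then show ?thesis
        unfolding sum' b_def by (simp add: algebra_simps sum_subtractf sum_distrib_left)
    qed
    moreover have "finite F'" "F' \<subseteq> X"
      using F x0 by (auto simp: F'_def)
    ultimately show ?thesis by blast
  qed
qed

context rkhs
begin

lemma combination_mem:
  assumes "finite J" "\<And>i. i \<in> J \<Longrightarrow> x i \<in> X"
  shows "(\<lambda>y. \<Sum>i\<in>J. c i * ksection X k (x i) y) \<in> H"
  using assms
proof (induction J)
  case empty
  show ?case by (simp add: zero_mem)
next
  case (insert i J)
  then show ?case
    using add_mem[OF scale_mem[OF section_mem[of "x i"], of "c i"]] by simp
qed

lemma ip_combination:
  assumes "finite J" "\<And>i. i \<in> J \<Longrightarrow> x i \<in> X" "g \<in> H"
  shows "ip (\<lambda>y. \<Sum>i\<in>J. c i * ksection X k (x i) y) g = (\<Sum>i\<in>J. c i * g (x i))"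
  using assms
proof (induction J)
  case empty
  show ?case using ip_scale[OF zero_mem empty.prems(2), of 0] by simp
next
  case (insert i J)
  have i: "ksection X k (x i) \<in> H" using insert.prems by (simp add: section_mem)
  have "ip (\<lambda>y. c i * ksection X k (x i) y + (\<Sum>i\<in>J. c i * ksection X k (x i) y)) g =
      ip (\<lambda>y. c i * ksection X k (x i) y) g + ip (\<lambda>y. \<Sum>i\<in>J. c i * ksection X k (x i) y) g"
    using insert by (intro ip_add scale_mem i combination_mem) auto
  also have "ip (\<lambda>y. c i * ksection X k (x i) y) g = c i * g (x i)"
    using insert.prems i by (simp add: ip_scale ip_sym[OF i] reproducing)
  finally show ?case using insert by simp
qed

text \<open>Only one argument of \<open>ip f f\<close> is expanded; the reproducing property
  evaluates the other at the points \<open>x i\<close>. Keeping \<open>f\<close> unexpanded there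
  lets each application insert its own formula for \<open>f\<close> on \<open>X\<close>.\<close>

lemma hnorm_combination:
  assumes "finite J" "\<And>i. i \<in> J \<Longrightarrow> x i \<in> X"
    and f: "f = (\<lambda>y. \<Sum>i\<in>J. c i * ksection X k (x i) y)"
  shows "(hnorm ip f)\<^sup>2 = (\<Sum>i\<in>J. c i * f (x i))"
proof -
  have "f \<in> H" unfolding f using assms by (intro combination_mem)
  then have "(hnorm ip f)\<^sup>2 = ip f f" by (simp add: hnorm_def ip_nonneg)
  also have "\<dots> = (\<Sum>i\<in>J. c i * f (x i))"
    using ip_combination[where x = x and c = c, OF assms(1,2) \<open>f \<in> H\<close>] f by simp
  finally show ?thesis .
qed

end

section \<open>Discrepancies of finitely supported distributions\<close>

text \<open>The quadratic form rests on linearity and on the support in \<open>X\<close>. Total mass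
  one enters separately, with \<open>mean_operator\<close>.\<close>

definition finite_expect :: "'a set \<Rightarrow> 'a expect \<Rightarrow> bool" where
  "finite_expect X E \<longleftrightarrow> (\<exists>n x w. E = weighted n x w \<and> (\<forall>i\<in>{1..n}. x i \<in> X))"

text \<open>The signed measure \<open>E - E'\<close> as a functional: the squared discrepancy is its
  application to both arguments of the kernel.\<close>

definition expect_diff :: "'a expect \<Rightarrow> 'a expect \<Rightarrow> 'a expect" where
  "expect_diff E E' = (\<lambda>f. E f - E' f)"

lemma finite_expect_weighted: "(\<And>i. i \<in> {1..n} \<Longrightarrow> x i \<in> X) \<Longrightarrow> finite_expect X (weighted n x w)"
  unfolding finite_expect_def by blast

lemma finite_expect_cong:
  assumes "finite_expect X E" "\<And>x. x \<in> X \<Longrightarrow> f x = g x"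
  shows "E f = E g"
  using assms by (auto simp: finite_expect_def weighted_def intro!: sum.cong)

lemma finite_expect_push:
  assumes "finite_expect X E" "\<And>x. x \<in> X \<Longrightarrow> \<phi> x \<in> Y"
  shows "finite_expect Y (push E \<phi>)"
proof -
  obtain n x w where "E = weighted n x w" "\<forall>i\<in>{1..n}. x i \<in> X"
    using assms(1) unfolding finite_expect_def by blast
  then have "push E \<phi> = weighted n (\<phi> \<circ> x) w" "\<forall>i\<in>{1..n}. (\<phi> \<circ> x) i \<in> Y"
    using assms(2) by (auto simp: push_def weighted_def)
  then show ?thesis unfolding finite_expect_def by blast
qed

lemma finite_expect_add:
  "finite_expect X E \<Longrightarrow> E (\<lambda>x. f x + g x) = E f + E g"
  by (auto simp: finite_expect_def weighted_def algebra_simps sum.distrib)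

lemma finite_expect_scale:
  "finite_expect X E \<Longrightarrow> E (\<lambda>x. a * f x) = a * E f"
  by (auto simp: finite_expect_def weighted_def algebra_simps sum_distrib_left)

lemma mmd2_finite:
  assumes "rkhs X k H ip" "finite_expect X E" "finite_expect X E'"
  shows "mmd2 X k ip E E' = expect_diff E E' (\<lambda>y. expect_diff E E' (\<lambda>x. k x y))"
proof -
  interpret rkhs X k H ip by fact
  obtain n x w where E: "E = weighted n x w" "\<And>i. i \<in> {1..n} \<Longrightarrow> x i \<in> X"
    using assms(2) unfolding finite_expect_def by blast
  obtain m z v where E': "E' = weighted m z v" "\<And>i. i \<in> {1..m} \<Longrightarrow> z i \<in> X"
    using assms(3) unfolding finite_expect_def by blast
  \<comment> \<open>The union is disjoint, so a point that occurs in both samples keeps a term from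
    each, weighted by \<open>w\<close> and by \<open>- v\<close>.\<close>
  define J where "J = {1..n} <+> {1..m}"
  define pt where "pt = case_sum x z"
  define c where "c = case_sum w (\<lambda>j. - v j)"
  have J: "finite J" "\<And>i. i \<in> J \<Longrightarrow> pt i \<in> X"
    using E(2) E'(2) by (auto simp: J_def pt_def)
  have sumJ: "(\<Sum>i\<in>J. c i * f (pt i)) = expect_diff E E' f" for f
    unfolding J_def by (subst sum.Plus)
      (auto simp: c_def pt_def expect_diff_def E(1) E'(1) weighted_def sum_negf)
  define f where "f = (\<lambda>y. embedding X k E y - embedding X k E' y)"
  have fX: "f y = expect_diff E E' (\<lambda>x. k x y)" if "y \<in> X" for y
    using that by (simp add: f_def embedding_def expect_diff_def)
  have "f = (\<lambda>y. \<Sum>i\<in>J. c i * ksection X k (pt i) y)"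
  proof
    fix y
    show "f y = (\<Sum>i\<in>J. c i * ksection X k (pt i) y)"
    proof (cases "y \<in> X")
      case True
      then show ?thesis using sumJ[of "\<lambda>x. k x y"] by (simp add: fX ksection_def)
    qed (simp add: f_def embedding_def ksection_def)
  qed
  then have "(hnorm ip f)\<^sup>2 = expect_diff E E' f"
    using hnorm_combination[where x = pt and c = c and f = f, OF J] sumJ by simp
  \<comment> \<open>The formula \<open>fX\<close> holds on \<open>X\<close> only, which is enough
    because both supports lie there.\<close>
  also have "\<dots> = expect_diff E E' (\<lambda>y. expect_diff E E' (\<lambda>x. k x y))"
    using finite_expect_cong[OF assms(2) fX] finite_expect_cong[OF assms(3) fX]
    by (simp add: expect_diff_def)
  finally show ?thesis by (simp add: mmd2_def f_def)
qed

lemma expect_diff_cong: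
  assumes "finite_expect X E" "finite_expect X E'" "\<And>x. x \<in> X \<Longrightarrow> f x = g x"
  shows "expect_diff E E' f = expect_diff E E' g"
  using finite_expect_cong[OF assms(1,3)] finite_expect_cong[OF assms(2,3)]
  by (simp add: expect_diff_def)

lemma expect_diff_add:
  assumes "finite_expect X E" "finite_expect X E'"
  shows "expect_diff E E' (\<lambda>x. f x + g x) = expect_diff E E' f + expect_diff E E' g"
  unfolding expect_diff_def finite_expect_add[OF assms(1)] finite_expect_add[OF assms(2)] by simp

lemma expect_diff_scale:
  assumes "finite_expect X E" "finite_expect X E'"
  shows "expect_diff E E' (\<lambda>x. a * f x) = a * expect_diff E E' f"
  unfolding expect_diff_def finite_expect_scale[OF assms(1)] finite_expect_scale[OF assms(2)]
  by (simp add: algebra_simps)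

text \<open>The map \<phi> may identify inputs and need not reach all of \<open>Y\<close>: only the
  values \<open>k' (\<phi> x) (\<phi> x')\<close> at sample points enter. With the identity map this
  is a rescaling of the kernel, with \<open>a = 1\<close> it is transport to latent paths, and with
  the normalized pooled feature it does both.\<close>

lemma mmd2_push:
  assumes "rkhs X k H ip" "rkhs Y k' H' ip'"
    and fin: "finite_expect X E" "finite_expect X E'"
    and maps: "\<And>x. x \<in> X \<Longrightarrow> \<phi> x \<in> Y"
    and kernel: "\<And>x x'. x \<in> X \<Longrightarrow> x' \<in> X \<Longrightarrow> k x x' = a * k' (\<phi> x) (\<phi> x')"
  shows "mmd2 X k ip E E' = a * mmd2 Y k' ip' (push E \<phi>) (push E' \<phi>)"
proof -
  have "mmd2 X k ip E E' = expect_diff E E' (\<lambda>y. expect_diff E E' (\<lambda>x. k x y))"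
    using assms by (intro mmd2_finite)
  also have "\<dots> = expect_diff E E' (\<lambda>y. expect_diff E E' (\<lambda>x. a * k' (\<phi> x) (\<phi> y)))"
    using kernel by (intro expect_diff_cong[OF fin])
  also have "\<dots> = a * expect_diff E E' (\<lambda>y. expect_diff E E' (\<lambda>x. k' (\<phi> x) (\<phi> y)))"
    by (simp only: expect_diff_scale[OF fin])
  also have "\<dots> = a * mmd2 Y k' ip' (push E \<phi>) (push E' \<phi>)"
    using mmd2_finite[OF assms(2) finite_expect_push[OF fin(1) maps] finite_expect_push[OF fin(2) maps]]
    by (simp add: push_def expect_diff_def)
  finally show ?thesis .
qed

lemma mmd2_kernel_sum:
  assumes "rkhs X k H ip" "\<And>a. a \<in> A \<Longrightarrow> rkhs X (k' a) (H' a) (ip' a)"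
    and fin: "finite_expect X E" "finite_expect X E'" and "finite A"
    and kernel: "\<And>x x'. x \<in> X \<Longrightarrow> x' \<in> X \<Longrightarrow> k x x' = (\<Sum>a\<in>A. \<alpha> a * k' a x x')"
  shows "mmd2 X k ip E E' = (\<Sum>a\<in>A. \<alpha> a * mmd2 X (k' a) (ip' a) E E')"
proof -
  have diff_sum: "expect_diff E E' (\<lambda>y. \<Sum>a\<in>A. \<alpha> a * f a y) = (\<Sum>a\<in>A. \<alpha> a * expect_diff E E' (f a))"
    for f
    using \<open>finite A\<close>
  proof (induction A)
    case empty
    show ?case using expect_diff_scale[OF fin, of 0] by simp
  next
    case (insert a A)
    then show ?case by (simp add: expect_diff_add[OF fin] expect_diff_scale[OF fin])
  qed
  have "mmd2 X k ip E E' = expect_diff E E' (\<lambda>y. expect_diff E E' (\<lambda>x. k x y))"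
    using assms by (intro mmd2_finite)
  also have "\<dots> = expect_diff E E' (\<lambda>y. expect_diff E E' (\<lambda>x. \<Sum>a\<in>A. \<alpha> a * k' a x y))"
    using kernel by (intro expect_diff_cong[OF fin])
  also have "\<dots> = (\<Sum>a\<in>A. \<alpha> a * expect_diff E E' (\<lambda>y. expect_diff E E' (\<lambda>x. k' a x y)))"
    by (simp only: diff_sum)
  also have "\<dots> = (\<Sum>a\<in>A. \<alpha> a * mmd2 X (k' a) (ip' a) E E')"
    using mmd2_finite[OF assms(2) fin] by (intro sum.cong) auto
  finally show ?thesis .
qed

section \<open>Mean operators and linear kernels\<close>

text \<open>\<open>I\<close> is the space of integrable functions: everything for finitely supported distributions.\<close>

locale mean_operator =
  fixes X :: "'a set" and I :: "('a \<Rightarrow> real) set" and E :: "'a expect"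
  assumes lin_mem: "\<lbrakk>f \<in> I; g \<in> I\<rbrakk> \<Longrightarrow> (\<lambda>x. a * f x + g x) \<in> I"
    and lin: "\<lbrakk>f \<in> I; g \<in> I\<rbrakk> \<Longrightarrow> E (\<lambda>x. a * f x + g x) = a * E f + E g"
    and one_mem: "(\<lambda>_. 1) \<in> I"
    and one: "E (\<lambda>_. 1) = 1"
    and cong: "(\<And>x. x \<in> X \<Longrightarrow> f x = g x) \<Longrightarrow> E f = E g"
    and mem_cong: "\<lbrakk>\<And>x. x \<in> X \<Longrightarrow> f x = g x; f \<in> I\<rbrakk> \<Longrightarrow> g \<in> I"
begin

lemma zero_mem: "(\<lambda>_. 0) \<in> I" and zero: "E (\<lambda>_. 0) = 0"
  \<comment> \<open>Zero is obtained as \<open>-1 * 1 + 1\<close>, from the one function that is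
    known to be in \<open>I\<close>.\<close>
  using lin_mem[OF one_mem one_mem, of "-1"] lin[OF one_mem one_mem, of "-1"] by simp_all

lemma scale_mem: "f \<in> I \<Longrightarrow> (\<lambda>x. a * f x) \<in> I" and scale: "f \<in> I \<Longrightarrow> E (\<lambda>x. a * f x) = a * E f"
  using lin_mem[OF _ zero_mem, of f a] lin[OF _ zero_mem, of f a] zero by simp_all

lemma combination:
  assumes "finite J" "\<And>i. i \<in> J \<Longrightarrow> f i \<in> I"
  shows "(\<lambda>x. \<Sum>i\<in>J. u i * f i x) \<in> I \<and> E (\<lambda>x. \<Sum>i\<in>J. u i * f i x) = (\<Sum>i\<in>J. u i * E (f i))"
  using assms
proof (induction J)
  case empty
  then show ?case by (simp add: zero_mem zero)
next
  case (insert i J)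
  then show ?case
    using lin_mem[of "f i" "\<lambda>x. \<Sum>i\<in>J. u i * f i x" "u i"] lin[of "f i" "\<lambda>x. \<Sum>i\<in>J. u i * f i x" "u i"]
    by simp
qed

lemma sum_eq: "finite J \<Longrightarrow> (\<And>i. i \<in> J \<Longrightarrow> f i \<in> I) \<Longrightarrow> E (\<lambda>x. \<Sum>i\<in>J. u i * f i x) = (\<Sum>i\<in>J. u i * E (f i))"
  using combination by blast

lemma shifted_product:
  assumes "f \<in> I" "g \<in> I" "(\<lambda>x. f x * g x) \<in> I"
  shows "(\<lambda>x. (f x - a) * (g x - b)) \<in> I"
    and "E (\<lambda>x. (f x - a) * (g x - b)) = E (\<lambda>x. f x * g x) - a * E g - b * E f + a * b"
proof -
  \<comment> \<open>The expansion is nested as repeated \<open>a * f + g\<close>, the only shape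
    that \<open>lin_mem\<close> and \<open>lin\<close> accept, with the constant written as a
    multiple of \<open>1\<close>.\<close>
  have expand: "(\<lambda>x. (f x - a) * (g x - b)) =
      (\<lambda>x. (-a) * g x + ((-b) * f x + (a * b * 1 + f x * g x)))"
    by (simp add: algebra_simps)
  have 1: "(\<lambda>x. a * b * 1 + f x * g x) \<in> I" by (rule lin_mem[OF one_mem assms(3)])
  have 2: "(\<lambda>x. (-b) * f x + (a * b * 1 + f x * g x)) \<in> I" by (rule lin_mem[OF assms(1) 1])
  show "(\<lambda>x. (f x - a) * (g x - b)) \<in> I"
    unfolding expand by (rule lin_mem[OF assms(2) 2])
  show "E (\<lambda>x. (f x - a) * (g x - b)) = E (\<lambda>x. f x * g x) - a * E g - b * E f + a * b"
    unfolding expand lin[OF assms(2) 2] lin[OF assms(1) 1] lin[OF one_mem assms(3)] one by simp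
qed

text \<open>Taking the preimage of \<open>I\<close> as the new space of integrable functions makes
  the change of variables true by definition. This is how each domain gets centered at its own
  mean.\<close>

lemma push:
  assumes "\<And>x. x \<in> X \<Longrightarrow> \<phi> x \<in> Y"
  shows "mean_operator Y {f. (\<lambda>x. f (\<phi> x)) \<in> I} (push E \<phi>)"
proof
  fix f g :: "'b \<Rightarrow> real" assume eq: "\<And>y. y \<in> Y \<Longrightarrow> f y = g y"
  show "push E \<phi> f = push E \<phi> g"
    unfolding push_def using eq assms by (intro cong) auto
  show "g \<in> {f. (\<lambda>x. f (\<phi> x)) \<in> I}" if "f \<in> {f. (\<lambda>x. f (\<phi> x)) \<in> I}"
    using that mem_cong[of "\<lambda>x. f (\<phi> x)" "\<lambda>x. g (\<phi> x)"] eq assms by auto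
qed (auto simp: push_def lin_mem lin one_mem one)

end

lemma mean_operator_weighted:
  assumes "\<And>i. i \<in> {1..n} \<Longrightarrow> x i \<in> X" "(\<Sum>i=1..n. w i) = 1"
  shows "mean_operator X UNIV (weighted n x w)"
proof
  fix f g :: "'a \<Rightarrow> real" and a
  show "weighted n x w (\<lambda>x. a * f x + g x) = a * weighted n x w f + weighted n x w g"
    by (simp add: weighted_def algebra_simps sum.distrib sum_distrib_left)
  show "weighted n x w f = weighted n x w g" if "\<And>x. x \<in> X \<Longrightarrow> f x = g x"
    using that assms(1) by (auto simp: weighted_def intro!: sum.cong)
qed (use assms(2) in \<open>auto simp: weighted_def\<close>)

lemma mean_operator_integral:
  assumes "prob_space P" "space P = X"
  shows "mean_operator X {f. integrable P f} (integral\<^sup>L P)"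
proof -
  interpret prob_space P by fact
  show ?thesis
  proof
    fix f g :: "'a \<Rightarrow> real" assume eq: "\<And>x. x \<in> X \<Longrightarrow> f x = g x"
    show "integral\<^sup>L P f = integral\<^sup>L P g"
      using eq assms(2) by (intro Bochner_Integration.integral_cong) auto
    show "g \<in> {f. integrable P f}" if "f \<in> {f. integrable P f}"
      using that eq assms(2) Bochner_Integration.integrable_cong[of P P f g] by auto
  qed (auto simp: prob_space)
qed

lemma mean_disc_sum: "mean_disc n \<phi> E E' = (\<Sum>i<n. (E (\<lambda>x. \<phi> x $ i) - E' (\<lambda>x. \<phi> x $ i))\<^sup>2)"
proof -
  have "mean_disc n \<phi> E E' = (mean_vec E n \<phi> - mean_vec E' n \<phi>) \<bullet> (mean_vec E n \<phi> - mean_vec E' n \<phi>)"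
    unfolding mean_disc_def l2norm_def
    by (rule real_sqrt_pow2) (auto simp: scalar_prod_def intro: sum_nonneg)
  then show ?thesis
    by (simp add: scalar_prod_def mean_vec_def power2_eq_square lessThan_atLeast0)
qed

lemma mean_disc_eq_0_iff: "mean_disc n \<phi> E E' = 0 \<longleftrightarrow> mean_vec E n \<phi> = mean_vec E' n \<phi>"
  unfolding mean_disc_sum
  by (subst sum_nonneg_eq_0_iff) (auto simp: mean_vec_def vec_eq_iff)

lemma mean_disc_nonneg: "0 \<le> mean_disc n \<phi> E E'"
  by (simp add: mean_disc_def)

text \<open>
  The RKHS norm of \<open>y \<mapsto> w \<bullet> \<phi> y\<close> is the norm of the projection of \<open>w\<close> onto the span of \<open>\<phi> ` X\<close>.
  Mean vectors already lie in this span, as they are annihilated by everything orthogonal to \<open>\<phi> ` X\<close>.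
\<close>

lemma mmd2_linear_kernel:
  assumes rkhs: "rkhs X (linear_kernel \<phi>) H ip"
    and dim: "\<And>x. x \<in> X \<Longrightarrow> \<phi> x \<in> carrier_vec n"
    and E: "mean_operator X I E" "\<And>i. i < n \<Longrightarrow> (\<lambda>x. \<phi> x $ i) \<in> I"
    and E': "mean_operator X I' E'" "\<And>i. i < n \<Longrightarrow> (\<lambda>x. \<phi> x $ i) \<in> I'"
  shows "mmd2 X (linear_kernel \<phi>) ip E E' = mean_disc n \<phi> E E'"
proof -
  interpret rkhs X "linear_kernel \<phi>" H ip by fact
  interpret E: mean_operator X I E by fact
  interpret E': mean_operator X I' E' by fact
  define w where "w i = E (\<lambda>x. \<phi> x $ i) - E' (\<lambda>x. \<phi> x $ i)" for i
  have diff: "E (\<lambda>x. \<Sum>i<n. u i * \<phi> x $ i) - E' (\<lambda>x. \<Sum>i<n. u i * \<phi> x $ i) = (\<Sum>i<n. u i * w i)" for u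
    using E(2) E'(2) E.sum_eq[of "{..<n}" "\<lambda>i x. \<phi> x $ i" u] E'.sum_eq[of "{..<n}" "\<lambda>i x. \<phi> x $ i" u]
    by (simp add: w_def right_diff_distrib sum_subtractf)
  have "\<exists>F c. finite F \<and> F \<subseteq> X \<and> (\<forall>i<n. w i = (\<Sum>x\<in>F. c x * \<phi> x $ i))"
  proof (rule finite_combination_of_annihilated)
    fix u assume u: "\<forall>x\<in>X. (\<Sum>i<n. u i * \<phi> x $ i) = 0"
    have "E (\<lambda>x. \<Sum>i<n. u i * \<phi> x $ i) = 0" "E' (\<lambda>x. \<Sum>i<n. u i * \<phi> x $ i) = 0"
      using E.cong[of _ "\<lambda>_. 0"] E'.cong[of _ "\<lambda>_. 0"] u by (auto simp: E.zero E'.zero)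
    with diff[of u] show "(\<Sum>i<n. u i * w i) = 0" by simp
  qed
  then obtain F c where F: "finite F" "F \<subseteq> X" and w: "\<And>i. i < n \<Longrightarrow> w i = (\<Sum>x\<in>F. c x * \<phi> x $ i)"
    by blast
  define f where "f = (\<lambda>y. embedding X (linear_kernel \<phi>) E y - embedding X (linear_kernel \<phi>) E' y)"
  have kernel: "linear_kernel \<phi> x y = (\<Sum>i<n. \<phi> y $ i * \<phi> x $ i)" if "y \<in> X" for x y
    using dim[OF that] by (simp add: linear_kernel_def scalar_prod_def lessThan_atLeast0 mult.commute)
  have fX: "f y = (\<Sum>i<n. \<phi> y $ i * w i)" if "y \<in> X" for y
    using that diff[of "\<lambda>i. \<phi> y $ i"] by (simp add: f_def embedding_def kernel)
  have "f = (\<lambda>y. \<Sum>x\<in>F. c x * ksection X (linear_kernel \<phi>) x y)"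
  proof
    fix y
    show "f y = (\<Sum>x\<in>F. c x * ksection X (linear_kernel \<phi>) x y)"
    proof (cases "y \<in> X")
      case True
      have "f y = (\<Sum>i<n. \<Sum>x\<in>F. c x * (\<phi> y $ i * \<phi> x $ i))"
        unfolding fX[OF True] by (intro sum.cong) (auto simp: w sum_distrib_left algebra_simps)
      also have "\<dots> = (\<Sum>x\<in>F. c x * ksection X (linear_kernel \<phi>) x y)"
        using True by (subst sum.swap) (simp add: ksection_def kernel sum_distrib_left)
      finally show ?thesis .
    qed (simp add: f_def embedding_def ksection_def)
  qed
  then have "(hnorm ip f)\<^sup>2 = (\<Sum>x\<in>F. c x * f x)"
    using F by (intro hnorm_combination[where x = "\<lambda>x. x"]) auto
  \<comment> \<open>On \<open>F\<close> the value \<open>f x\<close> is the product of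
    \<open>\<phi> x\<close> with \<open>w\<close>. Summing against \<open>c\<close> first rebuilds a
    second copy of \<open>w\<close>, which leaves its squared length.\<close>
  also have "\<dots> = (\<Sum>x\<in>F. \<Sum>i<n. c x * \<phi> x $ i * w i)"
    using F fX by (intro sum.cong) (auto simp: sum_distrib_left mult.assoc)
  also have "\<dots> = (\<Sum>i<n. (\<Sum>x\<in>F. c x * \<phi> x $ i) * w i)"
    by (subst sum.swap) (simp add: sum_distrib_right)
  also have "\<dots> = (\<Sum>i<n. (w i)\<^sup>2)"
    by (intro sum.cong) (auto simp: w power2_eq_square)
  finally show ?thesis
    by (simp add: mmd2_def f_def mean_disc_sum w_def)
qed

section \<open>Feature vectors given by lists of coordinate functions\<close>

lemma list_feature_coord:
  assumes "\<And>x. x \<in> X \<Longrightarrow> \<phi> x = vec_of_list (map (\<lambda>h. h x) hs)" "i < length hs" "x \<in> X"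
  shows "\<phi> x $ i = (hs ! i) x"
  using assms by (simp add: vec_of_list_index)

text \<open>Quadratic and polynomial features are flattened concatenations. Summing over the list of
  their coordinate functions avoids arithmetic with positions in the flattened vector.\<close>

lemma mean_disc_list:
  assumes "mean_operator X I E" "mean_operator X I' E'"
    and \<phi>: "\<And>x. x \<in> X \<Longrightarrow> \<phi> x = vec_of_list (map (\<lambda>h. h x) hs)"
  shows "mean_disc (length hs) \<phi> E E' = (\<Sum>h\<leftarrow>hs. (E h - E' h)\<^sup>2)"
proof -
  interpret E: mean_operator X I E by fact
  interpret E': mean_operator X I' E' by fact
  have "E (\<lambda>x. \<phi> x $ i) = E (hs ! i)" "E' (\<lambda>x. \<phi> x $ i) = E' (hs ! i)" if "i < length hs" for i
    using list_feature_coord[of X \<phi>, OF \<phi> that] by (auto intro!: E.cong E'.cong)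
  then have "mean_disc (length hs) \<phi> E E' = (\<Sum>i<length hs. (E (hs ! i) - E' (hs ! i))\<^sup>2)"
    unfolding mean_disc_sum by simp
  then show ?thesis
    by (simp add: sum_list_sum_nth lessThan_atLeast0)
qed

lemma (in mean_operator) list_feature_mem:
  assumes "\<And>x. x \<in> X \<Longrightarrow> \<phi> x = vec_of_list (map (\<lambda>h. h x) hs)" "set hs \<subseteq> I" "i < length hs"
  shows "(\<lambda>x. \<phi> x $ i) \<in> I"
proof (rule mem_cong)
  show "hs ! i \<in> I" using assms by auto
  show "(hs ! i) x = \<phi> x $ i" if "x \<in> X" for x
    using list_feature_coord[of X \<phi>, OF assms(1,3) that] by simp
qed

text \<open>The converse of \<open>list_feature_mem\<close>. It reads the integrability of the
  products of two coordinates off the hypothesis on the vectorized outer product.\<close>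

lemma (in mean_operator) list_feature_coord_mem:
  assumes "\<And>x. x \<in> X \<Longrightarrow> \<phi> x = vec_of_list (map (\<lambda>h. h x) hs)"
    and "\<And>i. i < length hs \<Longrightarrow> (\<lambda>x. \<phi> x $ i) \<in> I"
  shows "set hs \<subseteq> I"
proof
  fix h assume "h \<in> set hs"
  then obtain i where i: "i < length hs" "h = hs ! i" by (auto simp: in_set_conv_nth)
  show "h \<in> I"
  proof (rule mem_cong)
    show "(\<lambda>x. \<phi> x $ i) \<in> I" using assms(2) i by simp
    show "\<phi> x $ i = h x" if "x \<in> X" for x
      using list_feature_coord[of X \<phi>, OF assms(1) i(1) that] i(2) by simp
  qed
qed

lemma mmd2_list_feature:
  assumes "rkhs X (linear_kernel \<phi>) H ip"
    and \<phi>: "\<And>x. x \<in> X \<Longrightarrow> \<phi> x = vec_of_list (map (\<lambda>h. h x) hs)"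
    and E: "mean_operator X I E" "set hs \<subseteq> I" and E': "mean_operator X I' E'" "set hs \<subseteq> I'"
  shows "mmd2 X (linear_kernel \<phi>) ip E E' = mean_disc (length hs) \<phi> E E'"
proof (rule mmd2_linear_kernel[OF assms(1) _ E(1) _ E'(1)])
  show "\<phi> x \<in> carrier_vec (length hs)" if "x \<in> X" for x
    by (simp add: \<phi>[OF that] carrier_vecI)
qed (use mean_operator.list_feature_mem[OF _ \<phi>] E E' in blast)+

text \<open>Row-major order, as in \<open>mat_to_list\<close>, so that vectorizing an outer product
  yields a grid without reordering.\<close>

definition grid :: "nat \<Rightarrow> (nat \<Rightarrow> nat \<Rightarrow> 'a) \<Rightarrow> 'a list" where
  "grid n G = concat (map (\<lambda>i. map (G i) [0..<n]) [0..<n])"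

lemma length_grid: "length (grid n G) = n * n"
  by (simp add: grid_def length_concat comp_def sum_list_triv)

lemma set_grid: "set (grid n G) = {G i j |i j. i < n \<and> j < n}"
  unfolding grid_def by fastforce

lemma sum_list_concat_map:
  fixes f :: "'b \<Rightarrow> real"
  shows "(\<Sum>x\<leftarrow>concat xss. f x) = (\<Sum>xs\<leftarrow>xss. \<Sum>x\<leftarrow>xs. f x)"
  by (induction xss) auto

lemma sum_list_grid:
  fixes f :: "'a \<Rightarrow> real"
  shows "(\<Sum>h\<leftarrow>grid n G. f h) = (\<Sum>i<n. \<Sum>j<n. f (G i j))"
  by (simp add: grid_def sum_list_concat_map comp_def interv_sum_list_conv_sum_set_nat lessThan_atLeast0)

lemma vectorize_outer:
  assumes "dim_vec v = n"
  shows "vectorize (outer v v) = vec_of_list (grid n (\<lambda>i j. v $ i * v $ j))"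
  using assms unfolding vectorize_def grid_def mat_to_list_def outer_def
  by (intro arg_cong[where f = vec_of_list] arg_cong[where f = concat] map_cong) auto

lemma map_grid: "map f (grid n G) = grid n (\<lambda>i j. f (G i j))"
  by (simp add: grid_def map_concat comp_def)

lemma vectorize_outer_list:
  assumes "dim_vec (\<psi> x) = n"
  shows "vectorize (outer (\<psi> x) (\<psi> x)) =
    vec_of_list (map (\<lambda>h. h x) (grid n (\<lambda>i j x. \<psi> x $ i * \<psi> x $ j)))"
  unfolding vectorize_outer[of "\<psi> x", OF assms] map_grid ..

text \<open>A difference of vectors takes its dimension from the second argument. Hence
  \<open>\<psi> x - \<mu>\<close> has dimension \<open>n\<close> for every \<open>x\<close>, also
  outside \<open>X\<close>.\<close>

lemma quad_feature_list:
  assumes "\<mu> \<in> carrier_vec n"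
  shows "quad_feature \<mu> (\<psi> x) =
    vec_of_list (map (\<lambda>h. h x) (grid n (\<lambda>i j x. (\<psi> x $ i - \<mu> $ i) * (\<psi> x $ j - \<mu> $ j))))"
proof -
  have "dim_vec (\<psi> x - \<mu>) = n" using assms by simp
  then show ?thesis
    unfolding quad_feature_def vectorize_outer[OF \<open>dim_vec (\<psi> x - \<mu>) = n\<close>] map_grid
    unfolding grid_def using assms
    by (intro arg_cong[where f = vec_of_list] arg_cong[where f = concat] map_cong) auto
qed

section \<open>Covariance matching\<close>

lemma coral_disc_sum:
  "coral_disc n \<psi> E E' = (\<Sum>i<n. \<Sum>j<n. (cov_mat E n \<psi> $$ (i, j) - cov_mat E' n \<psi> $$ (i, j))\<^sup>2)"
  unfolding coral_disc_def fnorm_def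
  by (subst real_sqrt_pow2) (auto simp: cov_mat_def intro!: sum_nonneg sum.cong)

text \<open>The parallel axis identity, entry by entry: moving the center from the mean to \<mu>
  adds a rank-one term.\<close>

lemma (in mean_operator) second_moment_about:
  assumes "\<And>i. i < n \<Longrightarrow> (\<lambda>x. \<psi> x $ i) \<in> I" "\<And>i j. i < n \<Longrightarrow> j < n \<Longrightarrow> (\<lambda>x. \<psi> x $ i * \<psi> x $ j) \<in> I"
    and "i < n" "j < n" "\<mu> \<in> carrier_vec n"
  shows "E (\<lambda>x. (\<psi> x $ i - \<mu> $ i) * (\<psi> x $ j - \<mu> $ j)) =
    cov_mat E n \<psi> $$ (i, j) + outer (mean_vec E n \<psi> - \<mu>) (mean_vec E n \<psi> - \<mu>) $$ (i, j)"
proof -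
  \<comment> \<open>Stated for arbitrary centers because it is used twice, at \<mu> and at the mean
    inside \<open>cov_mat\<close>.\<close>
  have "E (\<lambda>x. (\<psi> x $ i - a) * (\<psi> x $ j - b)) = E (\<lambda>x. \<psi> x $ i * \<psi> x $ j) -
      a * E (\<lambda>x. \<psi> x $ j) - b * E (\<lambda>x. \<psi> x $ i) + a * b" for a b
    using assms(3,4) by (intro shifted_product assms(1,2))
  then show ?thesis
    using assms(3-5) by (simp add: cov_mat_def outer_def mean_vec_def) (simp add: algebra_simps)
qed

text \<open>By \<open>second_moment_about\<close> the two mean features differ by the difference of
  the covariances plus that of the rank-one terms. The premise of the second claim cancels the
  latter.\<close>

lemma mmd2_quad_feature:
  assumes "rkhs X (linear_kernel (\<lambda>x. quad_feature \<mu> (\<psi> x))) H ip" and \<mu>: "\<mu> \<in> carrier_vec n"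
    and E: "mean_operator X I E" "\<And>i. i < n \<Longrightarrow> (\<lambda>x. \<psi> x $ i) \<in> I"
      "\<And>i j. i < n \<Longrightarrow> j < n \<Longrightarrow> (\<lambda>x. \<psi> x $ i * \<psi> x $ j) \<in> I"
    and E': "mean_operator X I' E'" "\<And>i. i < n \<Longrightarrow> (\<lambda>x. \<psi> x $ i) \<in> I'"
      "\<And>i j. i < n \<Longrightarrow> j < n \<Longrightarrow> (\<lambda>x. \<psi> x $ i * \<psi> x $ j) \<in> I'"
  shows "mmd2 X (linear_kernel (\<lambda>x. quad_feature \<mu> (\<psi> x))) ip E E' =
      mean_disc (n * n) (\<lambda>x. quad_feature \<mu> (\<psi> x)) E E'"
    and "outer (mean_vec E n \<psi> - \<mu>) (mean_vec E n \<psi> - \<mu>) =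
        outer (mean_vec E' n \<psi> - \<mu>) (mean_vec E' n \<psi> - \<mu>) \<Longrightarrow>
      mmd2 X (linear_kernel (\<lambda>x. quad_feature \<mu> (\<psi> x))) ip E E' = coral_disc n \<psi> E E'"
proof -
  interpret E: mean_operator X I E by fact
  interpret E': mean_operator X I' E' by fact
  define hs where "hs = grid n (\<lambda>i j x. (\<psi> x $ i - \<mu> $ i) * (\<psi> x $ j - \<mu> $ j))"
  have len: "length hs = n * n" by (simp add: hs_def length_grid)
  have hs: "quad_feature \<mu> (\<psi> x) = vec_of_list (map (\<lambda>h. h x) hs)" for x
    unfolding hs_def by (rule quad_feature_list[OF \<mu>])
  have "set hs \<subseteq> I" "set hs \<subseteq> I'"
    using E E' by (auto simp: hs_def set_grid intro!: E.shifted_product E'.shifted_product)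
  then show mean: "mmd2 X (linear_kernel (\<lambda>x. quad_feature \<mu> (\<psi> x))) ip E E' =
      mean_disc (n * n) (\<lambda>x. quad_feature \<mu> (\<psi> x)) E E'"
    using mmd2_list_feature[OF assms(1) hs E(1) _ E'(1)] len by simp
  assume rank_one: "outer (mean_vec E n \<psi> - \<mu>) (mean_vec E n \<psi> - \<mu>) =
    outer (mean_vec E' n \<psi> - \<mu>) (mean_vec E' n \<psi> - \<mu>)"
  have "mean_disc (n * n) (\<lambda>x. quad_feature \<mu> (\<psi> x)) E E' =
      (\<Sum>i<n. \<Sum>j<n. (E (\<lambda>x. (\<psi> x $ i - \<mu> $ i) * (\<psi> x $ j - \<mu> $ j)) -
        E' (\<lambda>x. (\<psi> x $ i - \<mu> $ i) * (\<psi> x $ j - \<mu> $ j)))\<^sup>2)"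
    unfolding len[symmetric] mean_disc_list[OF E(1) E'(1) hs] by (simp add: hs_def sum_list_grid)
  also have "\<dots> = coral_disc n \<psi> E E'"
    unfolding coral_disc_sum
    by (intro sum.cong refl)
      (simp add: E.second_moment_about[OF E(2,3) _ _ \<mu>] E'.second_moment_about[OF E'(2,3) _ _ \<mu>] rank_one)
  finally show "mmd2 X (linear_kernel (\<lambda>x. quad_feature \<mu> (\<psi> x))) ip E E' = coral_disc n \<psi> E E'"
    using mean by simp
qed

text \<open>Source and target are centered by different maps, so no single feature map on
  \<open>X\<close> serves both. The kernel therefore lives on the feature space, and each domain is
  moved there by its own pushforward. Afterwards the expectation of an entry of the quadratic
  feature is the defining expression of \<open>cov_mat\<close>.\<close>

lemma mmd2_centered:
  fixes n :: nat and \<psi> :: "'a \<Rightarrow> real vec"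
  assumes "rkhs (carrier_vec n) (linear_kernel (quad_feature (0\<^sub>v n))) H ip"
    and E: "mean_operator X I E" "\<And>i. i < n \<Longrightarrow> (\<lambda>x. \<psi> x $ i) \<in> I"
      "\<And>i j. i < n \<Longrightarrow> j < n \<Longrightarrow> (\<lambda>x. \<psi> x $ i * \<psi> x $ j) \<in> I"
    and E': "mean_operator X I' E'" "\<And>i. i < n \<Longrightarrow> (\<lambda>x. \<psi> x $ i) \<in> I'"
      "\<And>i j. i < n \<Longrightarrow> j < n \<Longrightarrow> (\<lambda>x. \<psi> x $ i * \<psi> x $ j) \<in> I'"
  defines "C \<equiv> push E (\<lambda>x. \<psi> x - mean_vec E n \<psi>)" and "C' \<equiv> push E' (\<lambda>x. \<psi> x - mean_vec E' n \<psi>)"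
  shows "mmd2 (carrier_vec n) (linear_kernel (quad_feature (0\<^sub>v n))) ip C C' =
      mean_disc (n * n) (quad_feature (0\<^sub>v n)) C C'"
    and "mmd2 (carrier_vec n) (linear_kernel (quad_feature (0\<^sub>v n))) ip C C' = coral_disc n \<psi> E E'"
proof -
  interpret E: mean_operator X I E by fact
  interpret E': mean_operator X I' E' by fact
  define hs :: "(real vec \<Rightarrow> real) list" where
    "hs = grid n (\<lambda>i j v. (v $ i - 0\<^sub>v n $ i) * (v $ j - 0\<^sub>v n $ j))"
  have len: "length hs = n * n" by (simp add: hs_def length_grid)
  have hs: "quad_feature (0\<^sub>v n) v = vec_of_list (map (\<lambda>h. h v) hs)" for v
    unfolding hs_def using quad_feature_list[of "0\<^sub>v n" n "\<lambda>v. v" v] by simp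
  have coord: "(\<psi> x - mean_vec Q n \<psi>) $ i = \<psi> x $ i - mean_vec Q n \<psi> $ i" if "i < n" for x i Q
    using that by (simp add: mean_vec_def)
  have dim: "\<psi> x - mean_vec Q n \<psi> \<in> carrier_vec n" for x Q
    by (rule carrier_vecI) (simp add: mean_vec_def)
  note C = E.push[of "\<lambda>x. \<psi> x - mean_vec E n \<psi>", OF dim, folded C_def]
  note C' = E'.push[of "\<lambda>x. \<psi> x - mean_vec E' n \<psi>", OF dim, folded C'_def]
  have mem: "(\<lambda>x. (\<psi> x $ i - a) * (\<psi> x $ j - b)) \<in> I"
    "(\<lambda>x. (\<psi> x $ i - a) * (\<psi> x $ j - b)) \<in> I'" if "i < n" "j < n" for i j a b
    using that E E' by (auto intro!: E.shifted_product E'.shifted_product)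
  have "set hs \<subseteq> {f. (\<lambda>x. f (\<psi> x - mean_vec E n \<psi>)) \<in> I}"
    "set hs \<subseteq> {f. (\<lambda>x. f (\<psi> x - mean_vec E' n \<psi>)) \<in> I'}"
    by (auto simp: hs_def set_grid coord mem)
  then show mean: "mmd2 (carrier_vec n) (linear_kernel (quad_feature (0\<^sub>v n))) ip C C' =
      mean_disc (n * n) (quad_feature (0\<^sub>v n)) C C'"
    using mmd2_list_feature[OF assms(1) hs C _ C'] len by simp
  have "mean_disc (n * n) (quad_feature (0\<^sub>v n)) C C' = coral_disc n \<psi> E E'"
    unfolding len[symmetric] mean_disc_list[OF C C' hs] coral_disc_sum
    by (simp add: hs_def sum_list_grid C_def C'_def push_def coord cov_mat_def)
  with mean show "mmd2 (carrier_vec n) (linear_kernel (quad_feature (0\<^sub>v n))) ip C C' = coral_disc n \<psi> E E'"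
    by simp
qed

section \<open>Moment matching\<close>

lemma dim_tensor_pow: "dim_vec (tensor_pow m v) = dim_vec v ^ m"
  by (simp add: tensor_pow_def length_n_lists)

text \<open>The block lengths are fixed as \<open>n ^ m\<close>, so the list of coordinate functions
  does not depend on the input. It describes \<open>poly_feature\<close> wherever \<open>F x\<close>
  has dimension \<open>n\<close>.\<close>

definition poly_coords :: "(nat \<Rightarrow> real) \<Rightarrow> nat \<Rightarrow> nat \<Rightarrow> ('a \<Rightarrow> real vec) \<Rightarrow> ('a \<Rightarrow> real) list" where
  "poly_coords b p n F =
     concat (map (\<lambda>m. map (\<lambda>j x. b m * tensor_pow m (F x) $ j) [0..<n ^ m]) [0..<Suc p])"

lemma poly_feature_list:
  assumes "F x \<in> carrier_vec n"
  shows "poly_feature b p (F x) = vec_of_list (map (\<lambda>h. h x) (poly_coords b p n F))"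
proof -
  have "list_of_vec (b m \<cdot>\<^sub>v tensor_pow m (F x)) = map (\<lambda>j. b m * tensor_pow m (F x) $ j) [0..<n ^ m]" for m
    using assms by (intro nth_equalityI) (auto simp: dim_tensor_pow list_of_vec_index)
  then show ?thesis
    by (simp add: poly_feature_def poly_coords_def map_concat comp_def)
qed

lemma mmd2_poly_feature:
  assumes "rkhs X (linear_kernel (\<lambda>x. poly_feature b p (F x))) H ip"
    and F: "\<And>x. x \<in> X \<Longrightarrow> F x \<in> carrier_vec n"
    and E: "mean_operator X I E" "\<And>m j. m \<in> {1..p} \<Longrightarrow> j < n ^ m \<Longrightarrow> (\<lambda>x. tensor_pow m (F x) $ j) \<in> I"
    and E': "mean_operator X I' E'" "\<And>m j. m \<in> {1..p} \<Longrightarrow> j < n ^ m \<Longrightarrow> (\<lambda>x. tensor_pow m (F x) $ j) \<in> I'"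
  shows "mmd2 X (linear_kernel (\<lambda>x. poly_feature b p (F x))) ip E E' =
    (\<Sum>m=1..p. (b m)\<^sup>2 * homm_disc m n F E E')"
proof -
  interpret E: mean_operator X I E by fact
  interpret E': mean_operator X I' E' by fact
  \<comment> \<open>Order 0 has a single entry, the empty product, so its integrability comes from
    \<open>one_mem\<close> and not from a moment assumption.\<close>
  have const: "(\<lambda>x. tensor_pow 0 (F x) $ 0) = (\<lambda>_. 1)"
    by (simp add: tensor_pow_def)
  have "(\<lambda>x. tensor_pow m (F x) $ j) \<in> I" "(\<lambda>x. tensor_pow m (F x) $ j) \<in> I'"
    if "m \<le> p" "j < n ^ m" for m j
    using that E(2)[of m j] E'(2)[of m j] by (cases m; simp add: const E.one_mem E'.one_mem)+
  note mem = this
  define hs where "hs = poly_coords b p n F"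
  have hs: "poly_feature b p (F x) = vec_of_list (map (\<lambda>h. h x) hs)" if "x \<in> X" for x
    unfolding hs_def by (rule poly_feature_list[of F, OF F[OF that]])
  have "set hs \<subseteq> I" "set hs \<subseteq> I'"
    using mem by (auto simp: hs_def poly_coords_def less_Suc_eq_le intro!: E.scale_mem E'.scale_mem
        simp del: upt_Suc)
  then have "mmd2 X (linear_kernel (\<lambda>x. poly_feature b p (F x))) ip E E' =
      mean_disc (length hs) (\<lambda>x. poly_feature b p (F x)) E E'"
    using mmd2_list_feature[OF assms(1) hs E(1) _ E'(1)] by simp
  also have "\<dots> = (\<Sum>h\<leftarrow>hs. (E h - E' h)\<^sup>2)"
    by (rule mean_disc_list[OF E(1) E'(1) hs])
  also have "\<dots> = (\<Sum>m<Suc p. \<Sum>j<n ^ m.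
      (E (\<lambda>x. b m * tensor_pow m (F x) $ j) - E' (\<lambda>x. b m * tensor_pow m (F x) $ j))\<^sup>2)"
    by (simp add: hs_def poly_coords_def sum_list_concat_map comp_def lessThan_atLeast0
        interv_sum_list_conv_sum_set_nat del: upt_Suc sum.op_ivl_Suc)
  also have "\<dots> = (\<Sum>m<Suc p. (b m)\<^sup>2 * homm_disc m n F E E')"
    unfolding homm_disc_def mean_disc_sum sum_distrib_left
    by (intro sum.cong refl)
      (simp add: E.scale E'.scale mem power_mult_distrib flip: right_diff_distrib)
  also have "\<dots> = (\<Sum>m=1..p. (b m)\<^sup>2 * homm_disc m n F E E')"
  proof -
    \<comment> \<open>Order 0 compares the total masses, and both are one.\<close>
    have "homm_disc 0 n F E E' = 0"
      by (simp add: homm_disc_def mean_disc_sum const E.one E'.one)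
    moreover have "{..<Suc p} = insert 0 {1..p}" by auto
    ultimately show ?thesis by simp
  qed
  finally show ?thesis .
qed

lemma homm_disc_nonneg: "0 \<le> homm_disc m n F E E'"
  by (simp add: homm_disc_def mean_disc_nonneg)

lemma homm_disc_eq_0_iff:
  "homm_disc m n F E E' = 0 \<longleftrightarrow>
   mean_vec E (n ^ m) (\<lambda>x. tensor_pow m (F x)) = mean_vec E' (n ^ m) (\<lambda>x. tensor_pow m (F x))"
  by (simp add: homm_disc_def mean_disc_eq_0_iff)

section \<open>Class weights and priors\<close>

lemma softmax_pos: "K \<ge> 1 \<Longrightarrow> softmax K v c > 0"
  by (auto simp: softmax_def intro!: divide_pos_pos sum_pos)

lemma sum_softmax: "K \<ge> 1 \<Longrightarrow> (\<Sum>c=1..K. softmax K v c) = 1"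
proof -
  assume "K \<ge> 1"
  then have "(\<Sum>c'=1..K. exp (v c')) > 0" by (intro sum_pos) auto
  then show ?thesis by (simp add: softmax_def flip: sum_divide_distrib)
qed

lemma sum_tgt_prior:
  assumes "nt \<ge> 1" "\<And>x. (\<Sum>c=1..K. q c x) = 1"
  shows "(\<Sum>c=1..K. tgt_prior nt xt q c) = 1"
  using assms unfolding tgt_prior_def sum_distrib_left[symmetric] by (subst sum.swap) simp

lemma tgt_prior_pos:
  assumes "nt \<ge> 1" "\<And>x. q c x > 0"
  shows "tgt_prior nt xt q c > 0"
  using assms by (auto simp: tgt_prior_def intro!: divide_pos_pos sum_pos)

text \<open>For a class without samples the division by zero would make all weights 0, and the
  weighted expectation would have mass zero.\<close>

lemma sum_src_weight:
  assumes "\<exists>i\<in>{1..ns}. y i = c"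
  shows "(\<Sum>i=1..ns. src_weight ns y c i) = 1"
proof -
  have "(\<Sum>i=1..ns. of_bool (y i = c) :: real) > 0"
  proof -
    obtain i where i: "i \<in> {1..ns}" "y i = c" using assms by blast
    then show ?thesis by (intro sum_pos2[OF _ i(1)]) auto
  qed
  then show ?thesis
    unfolding src_weight_def sum_divide_distrib[symmetric] by (intro divide_self) (rule less_imp_neq[symmetric])
qed

lemma sum_tgt_weight:
  assumes "nt \<ge> 1" "\<And>x. q c x > 0"
  shows "(\<Sum>j=1..nt. tgt_weight nt xt q c j) = 1"
proof -
  have "(\<Sum>j=1..nt. q c (xt j)) > 0"
    using assms by (intro sum_pos) auto
  then show ?thesis
    unfolding tgt_weight_def sum_divide_distrib[symmetric] by (intro divide_self) simp
qed

text \<open>Without class conditioning the discrepancy is a weighted average of equal terms.\<close>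

lemma cpda2_const:
  assumes "(\<Sum>c=1..K. \<pi> c) = 1"
  shows "cpda2 X k ip K \<pi> (\<lambda>_. E) (\<lambda>_. E') = mmd2 X k ip E E'"
  using assms by (simp add: cpda2_def flip: sum_distrib_right)

section \<open>The CPDA kernel\<close>

lemma cpda_kernel_path: "cpda_kernel L x x' = path_kernel L (latent L x) (latent L x')"
  by (simp add: cpda_kernel_def path_kernel_def rep_kernel_def)

lemma cpda_kernel_sum: "cpda_kernel L x x' = (\<Sum>a\<in>{Sig, Spec, Path, Pool}. alpha L a * rep_kernel L a x x')"
  by (simp add: cpda_kernel_def)

lemma cpda_kernel_pool:
  assumes "alpha L Sig = 0" "alpha L Spec = 0" "alpha L Path = 0"
  shows "cpda_kernel L x x' = alpha L Pool * rep_kernel L Pool x x'"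
  using assms by (simp add: cpda_kernel_def)

lemma normalized_pool_carrier: "normalized (rep_of L Pool z) \<in> carrier_vec (ldim L)"
  by (simp add: normalized_def pool_rep_def)

theorem proposition3:
  fixes X :: "((real ^ 'L) ^ 'C) set"
    and ns nt K :: nat
    and xs xt :: "nat \<Rightarrow> (real ^ 'L) ^ 'C"
    and y :: "nat \<Rightarrow> nat"
    and Ps Pt :: "((real ^ 'L) ^ 'C) measure"
    and L :: "((real ^ 'L) ^ 'C) layer"
    and g :: "path \<Rightarrow> nat \<Rightarrow> real"
    and q :: "nat \<Rightarrow> (real ^ 'L) ^ 'C \<Rightarrow> real"
    and \<pi> :: "nat \<Rightarrow> real"
    and Es Et :: "nat \<Rightarrow> ((real ^ 'L) ^ 'C) expect"
    and Us Ut :: "((real ^ 'L) ^ 'C) expect"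
  assumes K: "K \<ge> 1"
    and src: "\<And>i. i \<in> {1..ns} \<Longrightarrow> xs i \<in> X \<and> y i \<in> {1..K}"
    and classes: "\<And>c. c \<in> {1..K} \<Longrightarrow> \<exists>i\<in>{1..ns}. y i = c"
    and tgt: "nt \<ge> 1" "\<And>j. j \<in> {1..nt} \<Longrightarrow> xt j \<in> X"
    and Ps: "prob_space Ps" "sets Ps = sets (restrict_space borel X)"
    and Pt: "prob_space Pt" "sets Pt = sets (restrict_space borel X)"
    and L: "valid_layer X L"
    and q: "q = (\<lambda>c x. softmax K (g (latent L x)) c)"
    and \<pi>: "\<pi> = tgt_prior nt xt q"
    and Es: "Es = (\<lambda>c. weighted ns xs (src_weight ns y c))"
    and Et: "Et = (\<lambda>c. weighted nt xt (tgt_weight nt xt q c))"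
    and Us: "Us = uniform ns xs"
    and Ut: "Ut = uniform nt xt"
  shows
   "(alpha L Sig = 0 \<and> alpha L Spec = 0 \<and> alpha L Path = 0 \<and> alpha L Pool > 0 \<longrightarrow>
      (\<forall>H ip. rkhs X (cpda_kernel L) H ip \<longrightarrow>
         cpda2 X (cpda_kernel L) ip K \<pi> (\<lambda>_. Us) (\<lambda>_. Ut) = mmd2 X (cpda_kernel L) ip Us Ut \<and>
         (\<forall>H' ip'. rkhs X (rep_kernel L Pool) H' ip' \<longrightarrow>
            cpda2 X (cpda_kernel L) ip K \<pi> (\<lambda>_. Us) (\<lambda>_. Ut) =
              alpha L Pool * mmd2 X (rep_kernel L Pool) ip' Us Ut) \<and>
         (\<forall>H' ip'.
            rkhs (carrier_vec (ldim L)) (gauss_kernel (nscales L) (bandwidth L Pool)) H' ip' \<longrightarrow>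
            cpda2 X (cpda_kernel L) ip K \<pi> (\<lambda>_. Us) (\<lambda>_. Ut) =
              alpha L Pool *
              mmd2 (carrier_vec (ldim L)) (gauss_kernel (nscales L) (bandwidth L Pool)) ip'
                (push Us (\<lambda>x. normalized (rep_of L Pool (latent L x))))
                (push Ut (\<lambda>x. normalized (rep_of L Pool (latent L x)))))))
    \<and>
    (\<forall>\<psi> H ip.
      \<psi> = (\<lambda>x. rep_of L Pool (latent L x)) \<and> rkhs X (linear_kernel \<psi>) H ip \<longrightarrow>
        cpda2 X (linear_kernel \<psi>) ip K \<pi> (\<lambda>_. Us) (\<lambda>_. Ut) = mean_disc (ldim L) \<psi> Us Ut \<and>
        (integrable_vec Ps (ldim L) \<psi> \<and> integrable_vec Pt (ldim L) \<psi> \<longrightarrow>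
          cpda2 X (linear_kernel \<psi>) ip K \<pi> (\<lambda>_. integral\<^sup>L Ps) (\<lambda>_. integral\<^sup>L Pt) =
            mean_disc (ldim L) \<psi> (integral\<^sup>L Ps) (integral\<^sup>L Pt)) \<and>
        cpda2 X (linear_kernel \<psi>) ip K \<pi> Es Et =
          (\<Sum>c=1..K. \<pi> c * mean_disc (ldim L) \<psi> (Es c) (Et c)))
    \<and>
    (\<forall>n \<psi>. (\<forall>x\<in>X. \<psi> x \<in> carrier_vec n) \<longrightarrow>
      (\<forall>Qs Qt.
        Qs = Us \<and> Qt = Ut \<or>
        Qs = integral\<^sup>L Ps \<and> Qt = integral\<^sup>L Pt \<and>
          (\<forall>P\<in>{Ps, Pt}. integrable_vec P n \<psi> \<and>
             integrable_vec P (n * n) (\<lambda>x. vectorize (outer (\<psi> x) (\<psi> x)))) \<or>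
        (\<exists>c\<in>{1..K}. Qs = Es c \<and> Qt = Et c) \<longrightarrow>
        (\<forall>\<mu>\<in>carrier_vec n. \<forall>H ip.
          rkhs X (linear_kernel (\<lambda>x. quad_feature \<mu> (\<psi> x))) H ip \<longrightarrow>
            cpda2 X (linear_kernel (\<lambda>x. quad_feature \<mu> (\<psi> x))) ip K \<pi> (\<lambda>_. Qs) (\<lambda>_. Qt) =
              mmd2 X (linear_kernel (\<lambda>x. quad_feature \<mu> (\<psi> x))) ip Qs Qt \<and>
            mmd2 X (linear_kernel (\<lambda>x. quad_feature \<mu> (\<psi> x))) ip Qs Qt =
              mean_disc (n * n) (\<lambda>x. quad_feature \<mu> (\<psi> x)) Qs Qt \<and>
            (outer (mean_vec Qs n \<psi> - \<mu>) (mean_vec Qs n \<psi> - \<mu>) =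
               outer (mean_vec Qt n \<psi> - \<mu>) (mean_vec Qt n \<psi> - \<mu>) \<longrightarrow>
             mmd2 X (linear_kernel (\<lambda>x. quad_feature \<mu> (\<psi> x))) ip Qs Qt =
               coral_disc n \<psi> Qs Qt)) \<and>
        (\<forall>H ip. rkhs (carrier_vec n) (linear_kernel (quad_feature (0\<^sub>v n))) H ip \<longrightarrow>
            mmd2 (carrier_vec n) (linear_kernel (quad_feature (0\<^sub>v n))) ip
              (push Qs (\<lambda>x. \<psi> x - mean_vec Qs n \<psi>)) (push Qt (\<lambda>x. \<psi> x - mean_vec Qt n \<psi>)) =
            mean_disc (n * n) (quad_feature (0\<^sub>v n))
              (push Qs (\<lambda>x. \<psi> x - mean_vec Qs n \<psi>)) (push Qt (\<lambda>x. \<psi> x - mean_vec Qt n \<psi>)) \<and>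
            mmd2 (carrier_vec n) (linear_kernel (quad_feature (0\<^sub>v n))) ip
              (push Qs (\<lambda>x. \<psi> x - mean_vec Qs n \<psi>)) (push Qt (\<lambda>x. \<psi> x - mean_vec Qt n \<psi>)) =
            coral_disc n \<psi> Qs Qt)))
    \<and>
    (\<forall>n F p b H ip.
      (\<forall>x\<in>X. F x \<in> carrier_vec n) \<and> rkhs X (linear_kernel (\<lambda>x. poly_feature b p (F x))) H ip \<longrightarrow>
      (\<forall>Qs Qt.
        Qs = (\<lambda>_. Us) \<and> Qt = (\<lambda>_. Ut) \<or>
        Qs = (\<lambda>_. integral\<^sup>L Ps) \<and> Qt = (\<lambda>_. integral\<^sup>L Pt) \<and>
          (\<forall>P\<in>{Ps, Pt}. \<forall>m\<in>{1..p}. integrable_vec P (n ^ m) (\<lambda>x. tensor_pow m (F x))) \<or>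
        Qs = Es \<and> Qt = Et \<longrightarrow>
        cpda2 X (linear_kernel (\<lambda>x. poly_feature b p (F x))) ip K \<pi> Qs Qt =
          (\<Sum>c=1..K. \<pi> c * (\<Sum>m=1..p. (b m)\<^sup>2 * homm_disc m n F (Qs c) (Qt c))) \<and>
        ((\<forall>m\<in>{1..p}. b m \<noteq> 0) \<longrightarrow>
          (cpda2 X (linear_kernel (\<lambda>x. poly_feature b p (F x))) ip K \<pi> Qs Qt = 0 \<longleftrightarrow>
           (\<forall>c\<in>{1..K}. \<forall>m\<in>{1..p}.
              mean_vec (Qs c) (n ^ m) (\<lambda>x. tensor_pow m (F x)) =
              mean_vec (Qt c) (n ^ m) (\<lambda>x. tensor_pow m (F x))))) \<and>
        (p \<ge> 1 \<and> b = (\<lambda>m. of_bool (m = p)) \<and> (\<exists>Q Q'. Qs = (\<lambda>_. Q) \<and> Qt = (\<lambda>_. Q')) \<longrightarrow>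
          cpda2 X (linear_kernel (\<lambda>x. poly_feature b p (F x))) ip K \<pi> Qs Qt =
            homm_disc p n F (Qs 1) (Qt 1))))
    \<and>
    (\<forall>N Ls H ip.
      (\<forall>l\<in>{1..N}. valid_layer X (Ls l) \<and> rkhs X (cpda_kernel (Ls l)) (H l) (ip l)) \<longrightarrow>
      (\<forall>H' ip'.
        (\<forall>l\<in>{1..N}. rkhs (path_space (Ls l)) (path_kernel (Ls l)) (H' l) (ip' l)) \<longrightarrow>
          multilayer_cpda2 N Ls X ip K \<pi> (\<lambda>_. Us) (\<lambda>_. Ut) =
            dan_objective N (\<lambda>l. path_space (Ls l)) (\<lambda>l. path_kernel (Ls l)) ip'
              (\<lambda>l. push Us (latent (Ls l))) (\<lambda>l. push Ut (latent (Ls l))) \<and>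
          multilayer_cpda2 N Ls X ip K \<pi> Es Et =
            (\<Sum>c=1..K. \<pi> c *
               dan_objective N (\<lambda>l. path_space (Ls l)) (\<lambda>l. path_kernel (Ls l)) ip'
                 (\<lambda>l. push (Es c) (latent (Ls l))) (\<lambda>l. push (Et c) (latent (Ls l))))) \<and>
      (\<forall>H' ip'.
        (\<forall>l\<in>{1..N}. alpha (Ls l) Sig = 0 \<and> alpha (Ls l) Spec = 0 \<and> alpha (Ls l) Path = 0 \<and>
           alpha (Ls l) Pool = 1 \<and>
           rkhs (carrier_vec (ldim (Ls l)))
             (gauss_kernel (nscales (Ls l)) (bandwidth (Ls l) Pool)) (H' l) (ip' l)) \<longrightarrow>
          multilayer_cpda2 N Ls X ip K \<pi> (\<lambda>_. Us) (\<lambda>_. Ut) =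
            dan_objective N (\<lambda>l. carrier_vec (ldim (Ls l)))
              (\<lambda>l. gauss_kernel (nscales (Ls l)) (bandwidth (Ls l) Pool)) ip'
              (\<lambda>l. push Us (\<lambda>x. normalized (rep_of (Ls l) Pool (latent (Ls l) x))))
              (\<lambda>l. push Ut (\<lambda>x. normalized (rep_of (Ls l) Pool (latent (Ls l) x))))) \<and>
      (\<forall>H' ip'.
        (\<forall>l\<in>{1..N}. \<forall>a. rkhs X (rep_kernel (Ls l) a) (H' l a) (ip' l a)) \<longrightarrow>
          multilayer_cpda2 N Ls X ip K \<pi> Es Et =
            (\<Sum>l=1..N. \<Sum>c=1..K. \<pi> c *
               (\<Sum>a\<in>{Sig, Spec, Path, Pool}.
                  alpha (Ls l) a * mmd2 X (rep_kernel (Ls l) a) (ip' l a) (Es c) (Et c)))))"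
proof -
  let "?marginal \<and> ?first_order \<and> ?covariance \<and> ?moments \<and> ?layers" = ?thesis
  have q_pos: "q c x > 0" and q_sum: "(\<Sum>c=1..K. q c x) = 1" for c x
    unfolding q by (rule softmax_pos[OF K], rule sum_softmax[OF K])
  have pi_sum: "(\<Sum>c=1..K. \<pi> c) = 1" and pi_pos: "\<pi> c > 0" for c
    using sum_tgt_prior[OF tgt(1) q_sum] tgt_prior_pos[of nt q c xt, OF tgt(1) q_pos] by (simp_all add: \<pi>)
  note const = cpda2_const[OF pi_sum]
  have xs: "xs i \<in> X" if "i \<in> {1..ns}" for i using src that by blast
  \<comment> \<open>Class 1 is nonempty, so the uniform source weights do sum to one.\<close>
  have "ns \<ge> 1" using classes[of 1] K by auto
  have finite: "finite_expect X Us" "finite_expect X Ut" "finite_expect X (Es c)" "finite_expect X (Et c)" for c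
    unfolding Us Ut Es Et uniform_def by (intro finite_expect_weighted xs tgt(2); assumption)+
  have op_U: "mean_operator X UNIV Us" "mean_operator X UNIV Ut"
    unfolding Us Ut uniform_def using \<open>ns \<ge> 1\<close> tgt xs by (intro mean_operator_weighted; simp)+
  \<comment> \<open>Unlike \<open>finite\<close>, this is restricted to classes in
    \<open>{1..K}\<close>: other labels have no source sample, so \<open>Es c\<close> would not be
    normalized.\<close>
  have op_E: "mean_operator X UNIV (Es c)" "mean_operator X UNIV (Et c)" if "c \<in> {1..K}" for c
    unfolding Es Et
    using sum_src_weight[OF classes[OF that]] sum_tgt_weight[OF tgt(1) q_pos] tgt(2) xs
    by (intro mean_operator_weighted; simp)+
  have "space Ps = X" "space Pt = X"
    using sets_eq_imp_space_eq[OF Ps(2)] sets_eq_imp_space_eq[OF Pt(2)] by (simp_all add: space_restrict_space)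
  then have op_P: "mean_operator X {f. integrable Ps f} (integral\<^sup>L Ps)"
    "mean_operator X {f. integrable Pt f} (integral\<^sup>L Pt)"
    using mean_operator_integral[OF Ps(1)] mean_operator_integral[OF Pt(1)] by simp_all

  \<comment> \<open>Marginal MMD on pooled features\<close>
  have marginal: ?marginal
  proof (intro impI allI conjI)
    fix H ip
    assume pool: "alpha L Sig = 0 \<and> alpha L Spec = 0 \<and> alpha L Path = 0 \<and> alpha L Pool > 0"
      and rkhs: "rkhs X (cpda_kernel L) H ip"
    then have kernel: "cpda_kernel L x x' = alpha L Pool * rep_kernel L Pool x x'" for x x'
      by (intro cpda_kernel_pool) auto
    show "cpda2 X (cpda_kernel L) ip K \<pi> (\<lambda>_. Us) (\<lambda>_. Ut) = mmd2 X (cpda_kernel L) ip Us Ut"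
      by (rule const)
    show "cpda2 X (cpda_kernel L) ip K \<pi> (\<lambda>_. Us) (\<lambda>_. Ut) = alpha L Pool * mmd2 X (rep_kernel L Pool) ip' Us Ut"
      if "rkhs X (rep_kernel L Pool) H' ip'" for H' ip'
      using mmd2_push[where \<phi> = "\<lambda>x. x", OF rkhs that finite(1,2) _ kernel]
      unfolding const by (simp add: push_def)
    show "cpda2 X (cpda_kernel L) ip K \<pi> (\<lambda>_. Us) (\<lambda>_. Ut) = alpha L Pool *
        mmd2 (carrier_vec (ldim L)) (gauss_kernel (nscales L) (bandwidth L Pool)) ip'
          (push Us (\<lambda>x. normalized (rep_of L Pool (latent L x))))
          (push Ut (\<lambda>x. normalized (rep_of L Pool (latent L x))))"
      if "rkhs (carrier_vec (ldim L)) (gauss_kernel (nscales L) (bandwidth L Pool)) H' ip'" for H' ip'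
      unfolding const
      by (rule mmd2_push[OF rkhs that finite(1,2) normalized_pool_carrier]) (simp only: kernel rep_kernel_def)
  qed

  \<comment> \<open>First-order mean matching\<close>
  have first_order: ?first_order
  proof (intro allI impI conjI; elim conjE)
    fix \<psi> H ip
    assume \<psi>: "\<psi> = (\<lambda>x. rep_of L Pool (latent L x))" and rkhs: "rkhs X (linear_kernel \<psi>) H ip"
    have dim: "\<psi> x \<in> carrier_vec (ldim L)" for x
      by (simp add: \<psi> pool_rep_def)
    note mmd = mmd2_linear_kernel[OF rkhs dim]
    show "cpda2 X (linear_kernel \<psi>) ip K \<pi> (\<lambda>_. Us) (\<lambda>_. Ut) = mean_disc (ldim L) \<psi> Us Ut"
      unfolding const by (rule mmd[OF op_U(1) _ op_U(2)]) auto
    show "cpda2 X (linear_kernel \<psi>) ip K \<pi> (\<lambda>_. integral\<^sup>L Ps) (\<lambda>_. integral\<^sup>L Pt) =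
        mean_disc (ldim L) \<psi> (integral\<^sup>L Ps) (integral\<^sup>L Pt)"
      if "integrable_vec Ps (ldim L) \<psi>" "integrable_vec Pt (ldim L) \<psi>"
      unfolding const by (rule mmd[OF op_P(1) _ op_P(2)]) (use that in \<open>auto simp: integrable_vec_def\<close>)
    show "cpda2 X (linear_kernel \<psi>) ip K \<pi> Es Et = (\<Sum>c=1..K. \<pi> c * mean_disc (ldim L) \<psi> (Es c) (Et c))"
      unfolding cpda2_def using mmd[OF op_E(1) _ op_E(2)] by (intro sum.cong) auto
  qed

  \<comment> \<open>Covariance matching (CORAL)\<close>
  have covariance: ?covariance
  proof (intro allI impI)
    fix n :: nat and \<psi> :: "(real ^ 'L) ^ 'C \<Rightarrow> real vec" and Qs Qt
    assume dim: "\<forall>x\<in>X. \<psi> x \<in> carrier_vec n"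
    assume "Qs = Us \<and> Qt = Ut \<or>
      Qs = integral\<^sup>L Ps \<and> Qt = integral\<^sup>L Pt \<and>
        (\<forall>P\<in>{Ps, Pt}. integrable_vec P n \<psi> \<and>
           integrable_vec P (n * n) (\<lambda>x. vectorize (outer (\<psi> x) (\<psi> x)))) \<or>
      (\<exists>c\<in>{1..K}. Qs = Es c \<and> Qt = Et c)"
    \<comment> \<open>From here on the three kinds of distributions are treated alike:
      \<open>I\<close> and \<open>I'\<close> are everything for samples and the integrable functions
      for measures.\<close>
    then obtain I I' where op: "mean_operator X I Qs" "mean_operator X I' Qt"
      and fst: "\<And>i. i < n \<Longrightarrow> (\<lambda>x. \<psi> x $ i) \<in> I" "\<And>i. i < n \<Longrightarrow> (\<lambda>x. \<psi> x $ i) \<in> I'"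
      and snd: "\<And>i j. i < n \<Longrightarrow> j < n \<Longrightarrow> (\<lambda>x. \<psi> x $ i * \<psi> x $ j) \<in> I"
        "\<And>i j. i < n \<Longrightarrow> j < n \<Longrightarrow> (\<lambda>x. \<psi> x $ i * \<psi> x $ j) \<in> I'"
    proof (elim disjE conjE bexE)
      assume *: "Qs = integral\<^sup>L Ps" "Qt = integral\<^sup>L Pt"
        and int: "\<forall>P\<in>{Ps, Pt}. integrable_vec P n \<psi> \<and>
           integrable_vec P (n * n) (\<lambda>x. vectorize (outer (\<psi> x) (\<psi> x)))"
      define hs :: "((real ^ 'L) ^ 'C \<Rightarrow> real) list" where "hs = grid n (\<lambda>i j x. \<psi> x $ i * \<psi> x $ j)"
      have hs: "vectorize (outer (\<psi> x) (\<psi> x)) = vec_of_list (map (\<lambda>h. h x) hs)" if "x \<in> X" for x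
        unfolding hs_def using that dim by (intro vectorize_outer_list) auto
      have "set hs \<subseteq> {f. integrable Ps f}" "set hs \<subseteq> {f. integrable Pt f}"
        using mean_operator.list_feature_coord_mem[OF op_P(1) hs] int
          mean_operator.list_feature_coord_mem[OF op_P(2) hs]
        by (auto simp: integrable_vec_def hs_def length_grid)
      then have "(\<lambda>x. \<psi> x $ i * \<psi> x $ j) \<in> {f. integrable Ps f}"
        "(\<lambda>x. \<psi> x $ i * \<psi> x $ j) \<in> {f. integrable Pt f}" if "i < n" "j < n" for i j
        using that unfolding hs_def set_grid by blast+
      with op_P int show thesis
        by (intro that[of "{f. integrable Ps f}" "{f. integrable Pt f}"])
          (simp_all add: integrable_vec_def *)
    qed (use op_U op_E in \<open>blast intro: that[of UNIV UNIV]\<close>)+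
    show "(\<forall>\<mu>\<in>carrier_vec n. \<forall>H ip.
          rkhs X (linear_kernel (\<lambda>x. quad_feature \<mu> (\<psi> x))) H ip \<longrightarrow>
            cpda2 X (linear_kernel (\<lambda>x. quad_feature \<mu> (\<psi> x))) ip K \<pi> (\<lambda>_. Qs) (\<lambda>_. Qt) =
              mmd2 X (linear_kernel (\<lambda>x. quad_feature \<mu> (\<psi> x))) ip Qs Qt \<and>
            mmd2 X (linear_kernel (\<lambda>x. quad_feature \<mu> (\<psi> x))) ip Qs Qt =
              mean_disc (n * n) (\<lambda>x. quad_feature \<mu> (\<psi> x)) Qs Qt \<and>
            (outer (mean_vec Qs n \<psi> - \<mu>) (mean_vec Qs n \<psi> - \<mu>) =
               outer (mean_vec Qt n \<psi> - \<mu>) (mean_vec Qt n \<psi> - \<mu>) \<longrightarrow>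
             mmd2 X (linear_kernel (\<lambda>x. quad_feature \<mu> (\<psi> x))) ip Qs Qt =
               coral_disc n \<psi> Qs Qt)) \<and>
        (\<forall>H ip. rkhs (carrier_vec n) (linear_kernel (quad_feature (0\<^sub>v n))) H ip \<longrightarrow>
            mmd2 (carrier_vec n) (linear_kernel (quad_feature (0\<^sub>v n))) ip
              (push Qs (\<lambda>x. \<psi> x - mean_vec Qs n \<psi>)) (push Qt (\<lambda>x. \<psi> x - mean_vec Qt n \<psi>)) =
            mean_disc (n * n) (quad_feature (0\<^sub>v n))
              (push Qs (\<lambda>x. \<psi> x - mean_vec Qs n \<psi>)) (push Qt (\<lambda>x. \<psi> x - mean_vec Qt n \<psi>)) \<and>
            mmd2 (carrier_vec n) (linear_kernel (quad_feature (0\<^sub>v n))) ip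
              (push Qs (\<lambda>x. \<psi> x - mean_vec Qs n \<psi>)) (push Qt (\<lambda>x. \<psi> x - mean_vec Qt n \<psi>)) =
            coral_disc n \<psi> Qs Qt)"
      by (intro conjI ballI allI impI const
          mmd2_quad_feature[OF _ _ op(1) fst(1) snd(1) op(2) fst(2) snd(2)]
          mmd2_centered[OF _ op(1) fst(1) snd(1) op(2) fst(2) snd(2)]; assumption)
  qed

  \<comment> \<open>Moments up to order \<open>p\<close> (HoMM)\<close>
  have moments: ?moments
  proof (intro allI impI; elim conjE)
    fix n :: nat and F :: "(real ^ 'L) ^ 'C \<Rightarrow> real vec" and p b H ip Qs Qt
    assume dim: "\<forall>x\<in>X. F x \<in> carrier_vec n"
      and rkhs: "rkhs X (linear_kernel (\<lambda>x. poly_feature b p (F x))) H ip"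
    assume Q: "Qs = (\<lambda>_. Us) \<and> Qt = (\<lambda>_. Ut) \<or>
        Qs = (\<lambda>_. integral\<^sup>L Ps) \<and> Qt = (\<lambda>_. integral\<^sup>L Pt) \<and>
          (\<forall>P\<in>{Ps, Pt}. \<forall>m\<in>{1..p}. integrable_vec P (n ^ m) (\<lambda>x. tensor_pow m (F x))) \<or>
        Qs = Es \<and> Qt = Et"
    let ?cpda = "cpda2 X (linear_kernel (\<lambda>x. poly_feature b p (F x))) ip K \<pi> Qs Qt"
    let ?hom = "\<lambda>c m. homm_disc m n F (Qs c) (Qt c)"
    have mmd: "mmd2 X (linear_kernel (\<lambda>x. poly_feature b p (F x))) ip (Qs c) (Qt c) =
        (\<Sum>m=1..p. (b m)\<^sup>2 * ?hom c m)" if c: "c \<in> {1..K}" for c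
    proof -
      obtain I I' where op: "mean_operator X I (Qs c)" "mean_operator X I' (Qt c)"
        and mem: "\<And>m j. m \<in> {1..p} \<Longrightarrow> j < n ^ m \<Longrightarrow> (\<lambda>x. tensor_pow m (F x) $ j) \<in> I"
          "\<And>m j. m \<in> {1..p} \<Longrightarrow> j < n ^ m \<Longrightarrow> (\<lambda>x. tensor_pow m (F x) $ j) \<in> I'"
        using Q
      proof (elim disjE conjE)
        assume "Qs = (\<lambda>_. integral\<^sup>L Ps)" "Qt = (\<lambda>_. integral\<^sup>L Pt)"
          "\<forall>P\<in>{Ps, Pt}. \<forall>m\<in>{1..p}. integrable_vec P (n ^ m) (\<lambda>x. tensor_pow m (F x))"
        with op_P show thesis
          by (intro that[of "{f. integrable Ps f}" "{f. integrable Pt f}"])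
            (simp_all add: integrable_vec_def)
      qed (use op_U op_E[OF c] in \<open>auto intro: that[of UNIV UNIV]\<close>)
      show ?thesis
        by (rule mmd2_poly_feature[OF rkhs _ op(1) mem(1) op(2) mem(2)]) (use dim in auto)
    qed
    have cpda: "?cpda = (\<Sum>c=1..K. \<pi> c * (\<Sum>m=1..p. (b m)\<^sup>2 * ?hom c m))"
      unfolding cpda2_def by (intro sum.cong) (auto simp: mmd)
    have "?cpda = 0 \<longleftrightarrow> (\<forall>c\<in>{1..K}. \<forall>m\<in>{1..p}.
        mean_vec (Qs c) (n ^ m) (\<lambda>x. tensor_pow m (F x)) =
        mean_vec (Qt c) (n ^ m) (\<lambda>x. tensor_pow m (F x)))" if b: "\<forall>m\<in>{1..p}. b m \<noteq> 0"
    proof -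
      have inner: "(\<Sum>m=1..p. (b m)\<^sup>2 * ?hom c m) = 0 \<longleftrightarrow> (\<forall>m\<in>{1..p}. ?hom c m = 0)" for c
        using b by (subst sum_nonneg_eq_0_iff) (auto simp: homm_disc_nonneg)
      \<comment> \<open>Softmax probabilities are strictly positive, hence so are the priors. A
        vanishing weighted sum thus forces every class term to vanish.\<close>
      have "?cpda = 0 \<longleftrightarrow> (\<forall>c\<in>{1..K}. (\<Sum>m=1..p. (b m)\<^sup>2 * ?hom c m) = 0)"
        unfolding cpda using less_imp_neq[OF pi_pos]
        by (subst sum_nonneg_eq_0_iff)
          (auto intro!: mult_nonneg_nonneg sum_nonneg simp: homm_disc_nonneg less_imp_le[OF pi_pos])
      then show ?thesis by (simp only: inner homm_disc_eq_0_iff)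
    qed
    moreover have "?cpda = ?hom 1 p"
      if "p \<ge> 1 \<and> b = (\<lambda>m. of_bool (m = p)) \<and> (\<exists>Q Q'. Qs = (\<lambda>_. Q) \<and> Qt = (\<lambda>_. Q'))"
    proof -
      \<comment> \<open>The families are constant, so class 1 represents all classes, and the
        indicator \<open>b\<close> leaves only the term of order \<open>p\<close>.\<close>
      have "(\<Sum>m=1..p. (b m)\<^sup>2 * ?hom c m) = ?hom 1 p" for c
      proof -
        have "(\<Sum>m=1..p. (b m)\<^sup>2 * ?hom c m) = (\<Sum>m=1..p. if m = p then ?hom 1 p else 0)"
          using that by (intro sum.cong) auto
        then show ?thesis using that by simp
      qed
      then show ?thesis unfolding cpda using pi_sum by (simp flip: sum_distrib_right)
    qed
    ultimately show "?cpda = (\<Sum>c=1..K. \<pi> c * (\<Sum>m=1..p. (b m)\<^sup>2 * ?hom c m)) \<and>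
        ((\<forall>m\<in>{1..p}. b m \<noteq> 0) \<longrightarrow>
          (?cpda = 0 \<longleftrightarrow> (\<forall>c\<in>{1..K}. \<forall>m\<in>{1..p}.
              mean_vec (Qs c) (n ^ m) (\<lambda>x. tensor_pow m (F x)) =
              mean_vec (Qt c) (n ^ m) (\<lambda>x. tensor_pow m (F x))))) \<and>
        (p \<ge> 1 \<and> b = (\<lambda>m. of_bool (m = p)) \<and> (\<exists>Q Q'. Qs = (\<lambda>_. Q) \<and> Qt = (\<lambda>_. Q')) \<longrightarrow>
          ?cpda = ?hom 1 p)"
      using cpda by blast
  qed

  \<comment> \<open>Several layers (DAN)\<close>
  have layers: ?layers
  proof (intro allI impI)
    fix N and Ls :: "nat \<Rightarrow> ((real ^ 'L) ^ 'C) layer" and H ip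
    assume Ls: "\<forall>l\<in>{1..N}. valid_layer X (Ls l) \<and> rkhs X (cpda_kernel (Ls l)) (H l) (ip l)"
    \<comment> \<open>A layer sees its inputs only through their latent paths, and
      \<open>valid_layer\<close> places these in \<open>path_space\<close>. So each layer term can
      be moved from inputs to paths.\<close>
    have paths: "mmd2 X (cpda_kernel (Ls l)) (ip l) E E' =
        mmd2 (path_space (Ls l)) (path_kernel (Ls l)) ipl (push E (latent (Ls l))) (push E' (latent (Ls l)))"
      if "l \<in> {1..N}" "rkhs (path_space (Ls l)) (path_kernel (Ls l)) Hl ipl"
        "finite_expect X E" "finite_expect X E'" for l Hl ipl E E'
    proof -
      have l: "rkhs X (cpda_kernel (Ls l)) (H l) (ip l)"
        using Ls that(1) by blast
      have maps: "latent (Ls l) x \<in> path_space (Ls l)" if "x \<in> X" for x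
        using Ls \<open>l \<in> {1..N}\<close> that unfolding valid_layer_def by blast
      show ?thesis
        using mmd2_push[where a = 1, OF l that(2-4) maps] by (simp add: cpda_kernel_path)
    qed
    show "(\<forall>H' ip'. (\<forall>l\<in>{1..N}. rkhs (path_space (Ls l)) (path_kernel (Ls l)) (H' l) (ip' l)) \<longrightarrow>
          multilayer_cpda2 N Ls X ip K \<pi> (\<lambda>_. Us) (\<lambda>_. Ut) =
            dan_objective N (\<lambda>l. path_space (Ls l)) (\<lambda>l. path_kernel (Ls l)) ip'
              (\<lambda>l. push Us (latent (Ls l))) (\<lambda>l. push Ut (latent (Ls l))) \<and>
          multilayer_cpda2 N Ls X ip K \<pi> Es Et =
            (\<Sum>c=1..K. \<pi> c *
               dan_objective N (\<lambda>l. path_space (Ls l)) (\<lambda>l. path_kernel (Ls l)) ip'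
                 (\<lambda>l. push (Es c) (latent (Ls l))) (\<lambda>l. push (Et c) (latent (Ls l))))) \<and>
      (\<forall>H' ip'.
        (\<forall>l\<in>{1..N}. alpha (Ls l) Sig = 0 \<and> alpha (Ls l) Spec = 0 \<and> alpha (Ls l) Path = 0 \<and>
           alpha (Ls l) Pool = 1 \<and>
           rkhs (carrier_vec (ldim (Ls l)))
             (gauss_kernel (nscales (Ls l)) (bandwidth (Ls l) Pool)) (H' l) (ip' l)) \<longrightarrow>
          multilayer_cpda2 N Ls X ip K \<pi> (\<lambda>_. Us) (\<lambda>_. Ut) =
            dan_objective N (\<lambda>l. carrier_vec (ldim (Ls l)))
              (\<lambda>l. gauss_kernel (nscales (Ls l)) (bandwidth (Ls l) Pool)) ip'
              (\<lambda>l. push Us (\<lambda>x. normalized (rep_of (Ls l) Pool (latent (Ls l) x))))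
              (\<lambda>l. push Ut (\<lambda>x. normalized (rep_of (Ls l) Pool (latent (Ls l) x))))) \<and>
      (\<forall>H' ip'.
        (\<forall>l\<in>{1..N}. \<forall>a. rkhs X (rep_kernel (Ls l) a) (H' l a) (ip' l a)) \<longrightarrow>
          multilayer_cpda2 N Ls X ip K \<pi> Es Et =
            (\<Sum>l=1..N. \<Sum>c=1..K. \<pi> c *
               (\<Sum>a\<in>{Sig, Spec, Path, Pool}.
                  alpha (Ls l) a * mmd2 X (rep_kernel (Ls l) a) (ip' l a) (Es c) (Et c))))"
    proof (intro conjI allI impI)
      fix H' ip'
      assume rkhs: "\<forall>l\<in>{1..N}. rkhs (path_space (Ls l)) (path_kernel (Ls l)) (H' l) (ip' l)"
      show "multilayer_cpda2 N Ls X ip K \<pi> (\<lambda>_. Us) (\<lambda>_. Ut) =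
          dan_objective N (\<lambda>l. path_space (Ls l)) (\<lambda>l. path_kernel (Ls l)) ip'
            (\<lambda>l. push Us (latent (Ls l))) (\<lambda>l. push Ut (latent (Ls l)))"
        unfolding multilayer_cpda2_def dan_objective_def const
        using rkhs finite by (intro sum.cong paths) auto
      have "multilayer_cpda2 N Ls X ip K \<pi> Es Et =
          (\<Sum>l=1..N. \<Sum>c=1..K. \<pi> c * mmd2 (path_space (Ls l)) (path_kernel (Ls l)) (ip' l)
            (push (Es c) (latent (Ls l))) (push (Et c) (latent (Ls l))))"
        unfolding multilayer_cpda2_def cpda2_def
        using rkhs finite by (intro sum.cong arg_cong2[where f = times] paths) auto
      then show "multilayer_cpda2 N Ls X ip K \<pi> Es Et =
          (\<Sum>c=1..K. \<pi> c *
             dan_objective N (\<lambda>l. path_space (Ls l)) (\<lambda>l. path_kernel (Ls l)) ip'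
               (\<lambda>l. push (Es c) (latent (Ls l))) (\<lambda>l. push (Et c) (latent (Ls l))))"
        \<comment> \<open>Exchanging the sums over layers and classes gives one DAN objective per
          class, averaged with the priors.\<close>
        by (subst (asm) sum.swap) (simp add: dan_objective_def sum_distrib_left)
    next
      fix H' ip'
      assume pool: "\<forall>l\<in>{1..N}. alpha (Ls l) Sig = 0 \<and> alpha (Ls l) Spec = 0 \<and> alpha (Ls l) Path = 0 \<and>
           alpha (Ls l) Pool = 1 \<and>
           rkhs (carrier_vec (ldim (Ls l)))
             (gauss_kernel (nscales (Ls l)) (bandwidth (Ls l) Pool)) (H' l) (ip' l)"
      have "mmd2 X (cpda_kernel (Ls l)) (ip l) Us Ut =
          mmd2 (carrier_vec (ldim (Ls l))) (gauss_kernel (nscales (Ls l)) (bandwidth (Ls l) Pool)) (ip' l)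
            (push Us (\<lambda>x. normalized (rep_of (Ls l) Pool (latent (Ls l) x))))
            (push Ut (\<lambda>x. normalized (rep_of (Ls l) Pool (latent (Ls l) x))))" if "l \<in> {1..N}" for l
      proof -
        \<comment> \<open>The pooling weight 1 is written as an explicit factor to match the scaled
          kernel in \<open>mmd2_push\<close>.\<close>
        have l: "rkhs X (cpda_kernel (Ls l)) (H l) (ip l)"
          "rkhs (carrier_vec (ldim (Ls l))) (gauss_kernel (nscales (Ls l)) (bandwidth (Ls l) Pool)) (H' l) (ip' l)"
          and kernel: "cpda_kernel (Ls l) x x' = 1 * rep_kernel (Ls l) Pool x x'" for x x'
          using pool Ls that cpda_kernel_pool[of "Ls l" x x'] by auto
        show ?thesis
          using mmd2_push[where a = 1, OF l finite(1,2) normalized_pool_carrier kernel[unfolded rep_kernel_def]]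
          by simp
      qed
      then show "multilayer_cpda2 N Ls X ip K \<pi> (\<lambda>_. Us) (\<lambda>_. Ut) =
          dan_objective N (\<lambda>l. carrier_vec (ldim (Ls l)))
            (\<lambda>l. gauss_kernel (nscales (Ls l)) (bandwidth (Ls l) Pool)) ip'
            (\<lambda>l. push Us (\<lambda>x. normalized (rep_of (Ls l) Pool (latent (Ls l) x))))
            (\<lambda>l. push Ut (\<lambda>x. normalized (rep_of (Ls l) Pool (latent (Ls l) x))))"
        unfolding multilayer_cpda2_def dan_objective_def const by (intro sum.cong) auto
    next
      fix H' ip'
      assume rkhs: "\<forall>l\<in>{1..N}. \<forall>a. rkhs X (rep_kernel (Ls l) a) (H' l a) (ip' l a)"
      have "mmd2 X (cpda_kernel (Ls l)) (ip l) (Es c) (Et c) = (\<Sum>a\<in>{Sig, Spec, Path, Pool}.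
          alpha (Ls l) a * mmd2 X (rep_kernel (Ls l) a) (ip' l a) (Es c) (Et c))" if "l \<in> {1..N}" for l c
        using Ls rkhs that finite by (intro mmd2_kernel_sum[where H' = "H' l"] cpda_kernel_sum) auto
      then show "multilayer_cpda2 N Ls X ip K \<pi> Es Et =
          (\<Sum>l=1..N. \<Sum>c=1..K. \<pi> c *
             (\<Sum>a\<in>{Sig, Spec, Path, Pool}.
                alpha (Ls l) a * mmd2 X (rep_kernel (Ls l) a) (ip' l a) (Es c) (Et c)))"
        unfolding multilayer_cpda2_def cpda2_def
        by (intro sum.cong refl arg_cong2[where f = times]) auto
    qed
  qed

  show ?thesis by (intro conjI marginal first_order covariance moments layers)
qed

end
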